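(* Let $\kappa \geq 3$ be a cardinal. There exists a family $\{T_\kappa^{[\alpha]} : 1 \leq \alpha < \omega_1\}$ of incomplete homogeneous real trees with valence $\kappa$ (i.e. every point has valence $\kappa$), indexed by the countable ordinals $\alpha \geq 1$, and, for all $1 \leq \alpha < \beta < \omega_1$, a fixed isometric embedding $\psi_{\alpha,\beta} : T_\kappa^{[\alpha]} \hookrightarrow T_\kappa^{[\beta]}$, such that: 1. for any countable ordinals $\alpha, \beta \geq 1$, if $\alpha \neq \beta$ then $T_\kappa^{[\alpha]}$ is not isometric to $T_\kappa^{[\beta]}$; 2. if $1 \leq \alpha < \beta < \gamma < \omega_1$, then $\psi_{\alpha,\gamma} = \psi_{\beta,\gamma} \circ \psi_{\alpha,\beta}$; 3. the direct union $\bigcup_{1 \leq \alpha < \omega_1} T_\kappa^{[\alpha]}$, taken with respect to $\{\psi_{\alpha,\beta} : 1 \leq \alpha < \beta < \omega_1\}$, is isometric to the universal real tree with valence $\kappa$.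
   Context: A real tree ($\mathbb{R}$-tree) is a geodesic metric space in which any pair of points is connected by a unique arc. For a real tree $T$ and $x \in T$, the directions of $T$ at $x$ are the connected components of $T - \{x\}$, and the valence of $T$ at $x$ is the cardinality of the set of directions at $x$. A real tree has valence $\kappa$ if its valence at every point is $\kappa$. A metric space is homogeneous if its isometry group acts transitively on it; it is incomplete if it is not complete as a metric space. For every cardinal $\kappa \geq 2$ there is, up to isometry, a unique complete real tree all of whose points have valence $\kappa$ (a known result); it is called the universal real tree with valence $\kappa$. The direct union of a directed system of isometric embeddings is the direct limit of the underlying sets, with the induced metric. *)

theory Defs
  imports "HOL-Analysis.Analysis"
begin

unbundle cardinal_syntax

section \<open>The countable ordinals\<close>

text \<open>
  The successor cardinal of \<open>natLeq\<close> is a well-order of type $\omega_1$, so the elements of its field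
  represent the ordinals $\alpha < \omega_1$.
\<close>

lemma Well_order_cardSuc_natLeq: "Well_order (cardSuc natLeq)"
  using cardSuc_Card_order[OF natLeq_Card_order] by (simp add: card_order_on_def)

typedef omega1 = "Field (cardSuc natLeq)"
proof -
  have "infinite (Field (cardSuc natLeq))"
    using cardSuc_finite[OF natLeq_Card_order] by (simp add: Field_natLeq)
  then show ?thesis
    by (metis finite.emptyI ex_in_conv)
qed

instantiation omega1 :: linorder
begin

definition less_eq_omega1 :: "omega1 \<Rightarrow> omega1 \<Rightarrow> bool" where
  "a \<le> b \<longleftrightarrow> (Rep_omega1 a, Rep_omega1 b) \<in> cardSuc natLeq"

definition less_omega1 :: "omega1 \<Rightarrow> omega1 \<Rightarrow> bool" where
  "(a::omega1) < b \<longleftrightarrow> a \<le> b \<and> a \<noteq> b"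

instance
proof
  note wo = Well_order_cardSuc_natLeq[unfolded order_on_defs]
  fix x y z :: omega1
  have anti: "x = y" if "x \<le> y" "y \<le> x" for x y :: omega1
    using that wo unfolding less_eq_omega1_def
    by (meson Rep_omega1_inject antisymD)
  show "(x < y) = (x \<le> y \<and> \<not> y \<le> x)"
    using anti less_omega1_def by metis
  show "x \<le> x"
    using wo Rep_omega1 unfolding less_eq_omega1_def by (metis refl_onD)
  show "x \<le> z" if "x \<le> y" "y \<le> z"
    using that wo unfolding less_eq_omega1_def by (meson transD)
  show "x = y" if "x \<le> y" "y \<le> x" by (rule anti[OF that])
  show "x \<le> y \<or> y \<le> x"
    using wo Rep_omega1[of x] Rep_omega1[of y] unfolding less_eq_omega1_def total_on_def
    by (metis refl_onD)
qed

end

instance omega1 :: wellorder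
proof
  fix P :: "omega1 \<Rightarrow> bool" and a
  assume step: "\<And>x. (\<And>y. y < x \<Longrightarrow> P y) \<Longrightarrow> P x"
  have "wf (cardSuc natLeq - Id)"
    using Well_order_cardSuc_natLeq by (simp add: well_order_on_def)
  then have "wf (inv_image (cardSuc natLeq - Id) Rep_omega1)"
    by (rule wf_inv_image)
  moreover have "inv_image (cardSuc natLeq - Id) Rep_omega1 = {(x, y). x < y}"
    by (auto simp: inv_image_def less_omega1_def less_eq_omega1_def Rep_omega1_inject)
  ultimately have "wf {(x, y :: omega1). x < y}" by simp
  then show "P a"
    by (induction a rule: wf_induct_rule) (use step in auto)
qed

instantiation omega1 :: "{zero, one}"
begin

definition zero_omega1 :: omega1 where "(0::omega1) = (LEAST a. True)"
definition one_omega1 :: omega1 where "(1::omega1) = (LEAST a. a \<noteq> 0)"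

instance ..

end

text \<open>
  These two facts say that \<^typ>\<open>omega1\<close> is ordered in type $\omega_1$: it is uncountable and every
  proper initial segment is countable.
\<close>

lemma uncountable_omega1: "\<not> countable (UNIV :: omega1 set)"
proof
  assume "countable (UNIV :: omega1 set)"
  then have "countable (Rep_omega1 ` UNIV)" by simp
  moreover have "Rep_omega1 ` UNIV = Field (cardSuc natLeq)"
    by (rule type_definition.Rep_range[OF type_definition_omega1])
  ultimately have "countable (Field (cardSuc natLeq))" by simp
  then have "|Field (cardSuc natLeq)| \<le>o |UNIV :: nat set|"
    by (metis countable_def card_of_ordLeq subset_UNIV)
  then have "cardSuc natLeq \<le>o natLeq"
    by (meson card_of_Field_ordIso card_of_nat cardSuc_Card_order natLeq_Card_order
        ordIso_ordLeq_trans ordIso_symmetric ordLeq_ordIso_trans)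
  then show False
    using cardSuc_greater[OF natLeq_Card_order] not_ordLeq_ordLess by blast
qed

lemma countable_lessThan_omega1: "countable {..<a :: omega1}"
proof -
  let ?r = "cardSuc natLeq"
  have "|underS ?r (Rep_omega1 a)| <o ?r"
    by (rule card_of_underS) (simp_all add: cardSuc_Card_order natLeq_Card_order Rep_omega1)
  then have "|underS ?r (Rep_omega1 a)| \<le>o natLeq"
    by (simp add: cardSuc_ordLeq_ordLess natLeq_Card_order card_of_Card_order)
  then have "|underS ?r (Rep_omega1 a)| \<le>o |UNIV :: nat set|"
    using card_of_nat ordIso_symmetric ordLeq_ordIso_trans by blast
  then have "countable (underS ?r (Rep_omega1 a))"
    unfolding countable_def by (simp flip: card_of_ordLeq)
  moreover have "Rep_omega1 ` {..<a} \<subseteq> underS ?r (Rep_omega1 a)"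
    by (auto simp: underS_def less_omega1_def less_eq_omega1_def Rep_omega1_inject)
  ultimately have "countable (Rep_omega1 ` {..<a})" by (rule countable_subset[rotated])
  then show ?thesis
    by (rule countable_image_inj_on) (simp add: inj_on_def Rep_omega1_inject)
qed

section \<open>Isometries\<close>

definition isometric_embedding :: "'a metric \<Rightarrow> 'b metric \<Rightarrow> ('a \<Rightarrow> 'b) \<Rightarrow> bool" where
  "isometric_embedding m n f \<longleftrightarrow> f \<in> mspace m \<rightarrow> mspace n \<and>
     (\<forall>x\<in>mspace m. \<forall>y\<in>mspace m. mdist n (f x) (f y) = mdist m x y)"

definition isometry :: "'a metric \<Rightarrow> 'b metric \<Rightarrow> ('a \<Rightarrow> 'b) \<Rightarrow> bool" where
  "isometry m n f \<longleftrightarrow> isometric_embedding m n f \<and> f ` mspace m = mspace n"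

definition isometric :: "'a metric \<Rightarrow> 'b metric \<Rightarrow> bool" where
  "isometric m n \<longleftrightarrow> (\<exists>f. isometry m n f)"

definition homogeneous :: "'a metric \<Rightarrow> bool" where
  "homogeneous m \<longleftrightarrow> (\<forall>x\<in>mspace m. \<forall>y\<in>mspace m. \<exists>f. isometry m m f \<and> f x = y)"

section \<open>Real trees\<close>

definition geodesic_metric :: "'a metric \<Rightarrow> bool" where
  "geodesic_metric m \<longleftrightarrow> (\<forall>x\<in>mspace m. \<forall>y\<in>mspace m. \<exists>g.
     g \<in> {0..mdist m x y} \<rightarrow> mspace m \<and> g 0 = x \<and> g (mdist m x y) = y \<and>
     (\<forall>s\<in>{0..mdist m x y}. \<forall>t\<in>{0..mdist m x y}. mdist m (g s) (g t) = \<bar>s - t\<bar>))"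

text \<open>
  As metric spaces are Hausdorff, an injective path is a homeomorphism onto its image.
\<close>

definition arc_between :: "'a metric \<Rightarrow> 'a \<Rightarrow> 'a \<Rightarrow> 'a set \<Rightarrow> bool" where
  "arc_between m x y A \<longleftrightarrow> (\<exists>g. pathin (mtopology_of m) g \<and> inj_on g {0..1} \<and>
     g 0 = x \<and> g 1 = y \<and> g ` {0..1} = A)"

text \<open>
  Arcs are identified with their images, since parametrisations are never unique.
  The empty space is excluded; otherwise it would have every valence.
\<close>

definition real_tree :: "'a metric \<Rightarrow> bool" where
  "real_tree m \<longleftrightarrow> mspace m \<noteq> {} \<and> geodesic_metric m \<and>
     (\<forall>x\<in>mspace m. \<forall>y\<in>mspace m. x \<noteq> y \<longrightarrow> (\<exists>!A. arc_between m x y A))"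

definition directions :: "'a metric \<Rightarrow> 'a \<Rightarrow> 'a set set" where
  "directions m x = connected_components_of (subtopology (mtopology_of m) (mspace m - {x}))"

definition valence :: "'a metric \<Rightarrow> 'a \<Rightarrow> 'a set rel" where
  "valence m x = |directions m x|"

definition has_valence :: "'a metric \<Rightarrow> 'k rel \<Rightarrow> bool" where
  "has_valence m \<kappa> \<longleftrightarrow> (\<forall>x\<in>mspace m. (valence m x, \<kappa>) \<in> ordIso)"

text \<open>By the uniqueness theorem, this determines \<open>m\<close> up to isometry.\<close>

definition universal_real_tree :: "'k rel \<Rightarrow> 'a metric \<Rightarrow> bool" where
  "universal_real_tree \<kappa> m \<longleftrightarrow> real_tree m \<and> mcomplete_of m \<and> has_valence m \<kappa>"

section \<open>Direct unions\<close>

text \<open>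
  The maps \<open>\<psi> i j\<close> are only meaningful for \<open>i < j\<close>; \<open>transition \<psi>\<close> adds the identities \<open>i = j\<close>.
\<close>

definition transition :: "('i \<Rightarrow> 'i \<Rightarrow> 'a \<Rightarrow> 'a) \<Rightarrow> 'i \<Rightarrow> 'i \<Rightarrow> 'a \<Rightarrow> 'a" where
  "transition \<psi> i j = (if i = j then id else \<psi> i j)"

definition direct_union_rel ::
  "'i::linorder set \<Rightarrow> ('i \<Rightarrow> 'a metric) \<Rightarrow> ('i \<Rightarrow> 'i \<Rightarrow> 'a \<Rightarrow> 'a) \<Rightarrow> ('i \<times> 'a) rel" where
  "direct_union_rel I T \<psi> = {((i, x), (j, y)).
     i \<in> I \<and> x \<in> mspace (T i) \<and> j \<in> I \<and> y \<in> mspace (T j) \<and>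
     (\<exists>k\<in>I. i \<le> k \<and> j \<le> k \<and> transition \<psi> i k x = transition \<psi> j k y)}"

definition direct_union_carrier ::
  "'i::linorder set \<Rightarrow> ('i \<Rightarrow> 'a metric) \<Rightarrow> ('i \<Rightarrow> 'i \<Rightarrow> 'a \<Rightarrow> 'a) \<Rightarrow> ('i \<times> 'a) set set" where
  "direct_union_carrier I T \<psi> = (SIGMA i:I. mspace (T i)) // direct_union_rel I T \<psi>"

definition direct_union_dist ::
  "'i::linorder set \<Rightarrow> ('i \<Rightarrow> 'a metric) \<Rightarrow> ('i \<Rightarrow> 'i \<Rightarrow> 'a \<Rightarrow> 'a) \<Rightarrow>
     ('i \<times> 'a) set \<Rightarrow> ('i \<times> 'a) set \<Rightarrow> real" where
  "direct_union_dist I T \<psi> X Y =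
     (if X \<in> direct_union_carrier I T \<psi> \<and> Y \<in> direct_union_carrier I T \<psi>
      then (THE r. \<exists>i x j y k. (i, x) \<in> X \<and> (j, y) \<in> Y \<and> k \<in> I \<and> i \<le> k \<and> j \<le> k \<and>
              r = mdist (T k) (transition \<psi> i k x) (transition \<psi> j k y))
      else 0)"

definition direct_union ::
  "'i::linorder set \<Rightarrow> ('i \<Rightarrow> 'a metric) \<Rightarrow> ('i \<Rightarrow> 'i \<Rightarrow> 'a \<Rightarrow> 'a) \<Rightarrow> ('i \<times> 'a) set metric" where
  "direct_union I T \<psi> = metric (direct_union_carrier I T \<psi>, direct_union_dist I T \<psi>)"

text \<open>
  For a directed system of isometric embeddings this is a genuine metric space, so that the
  type constructor \<^const>\<open>metric\<close> is applied within its domain.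
\<close>

context
  fixes I :: "'i::linorder set" and T :: "'i \<Rightarrow> 'a metric" and \<psi> :: "'i \<Rightarrow> 'i \<Rightarrow> 'a \<Rightarrow> 'a"
  assumes emb: "\<And>i j. \<lbrakk>i \<in> I; j \<in> I; i < j\<rbrakk> \<Longrightarrow> isometric_embedding (T i) (T j) (\<psi> i j)"
    and comp: "\<And>i j k x. \<lbrakk>i \<in> I; j \<in> I; k \<in> I; i < j; j < k; x \<in> mspace (T i)\<rbrakk>
                 \<Longrightarrow> \<psi> i k x = \<psi> j k (\<psi> i j x)"
begin

private lemma tr_in: "\<lbrakk>i \<in> I; j \<in> I; i \<le> j; x \<in> mspace (T i)\<rbrakk> \<Longrightarrow> transition \<psi> i j x \<in> mspace (T j)"
  using emb[of i j] by (cases "i = j") (auto simp: transition_def isometric_embedding_def less_le Pi_iff)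

private lemma tr_dist: "\<lbrakk>i \<in> I; j \<in> I; i \<le> j; x \<in> mspace (T i); y \<in> mspace (T i)\<rbrakk>
   \<Longrightarrow> mdist (T j) (transition \<psi> i j x) (transition \<psi> i j y) = mdist (T i) x y"
  using emb[of i j] by (cases "i = j") (auto simp: transition_def isometric_embedding_def less_le Pi_iff)

private lemma tr_tr:
  assumes "i \<in> I" "j \<in> I" "k \<in> I" "i \<le> j" "j \<le> k" "x \<in> mspace (T i)"
  shows "transition \<psi> j k (transition \<psi> i j x) = transition \<psi> i k x"
proof (cases "i = j \<or> j = k")
  case True
  then show ?thesis by (auto simp: transition_def)
next
  case False
  then have lt: "i < j" "j < k" using assms(4,5) by (simp_all add: order.strict_iff_order)
  have "\<psi> i k x = \<psi> j k (\<psi> i j x)" by (rule comp) (fact assms lt)+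
  then show ?thesis using lt by (simp add: transition_def less_imp_neq[OF less_trans[OF lt]] less_imp_neq)
qed

private lemma rel_iff:
  assumes "i \<in> I" "j \<in> I" "k \<in> I" "i \<le> k" "j \<le> k" "x \<in> mspace (T i)" "y \<in> mspace (T j)"
  shows "((i, x), (j, y)) \<in> direct_union_rel I T \<psi> \<longleftrightarrow> transition \<psi> i k x = transition \<psi> j k y"
proof
  assume "((i, x), (j, y)) \<in> direct_union_rel I T \<psi>"
  then obtain l where l: "l \<in> I" "i \<le> l" "j \<le> l" "transition \<psi> i l x = transition \<psi> j l y"
    by (auto simp: direct_union_rel_def)
  let ?m = "max k l"
  have m: "?m \<in> I" "k \<le> ?m" "l \<le> ?m" using assms l by (auto simp: max_def)
  have "mdist (T k) (transition \<psi> i k x) (transition \<psi> j k y)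
      = mdist (T ?m) (transition \<psi> i ?m x) (transition \<psi> j ?m y)"
    using tr_dist[of k ?m "transition \<psi> i k x" "transition \<psi> j k y"] tr_tr[of i k ?m x]
      tr_tr[of j k ?m y] tr_in[of i k x] tr_in[of j k y] assms m by simp
  also have "\<dots> = mdist (T l) (transition \<psi> i l x) (transition \<psi> j l y)"
    using tr_dist[of l ?m "transition \<psi> i l x" "transition \<psi> j l y"] tr_tr[of i l ?m x]
      tr_tr[of j l ?m y] tr_in[of i l x] tr_in[of j l y] assms m l by simp
  also have "\<dots> = 0" using l tr_in[of j l y] assms by simp
  finally show "transition \<psi> i k x = transition \<psi> j k y"
    using tr_in[of i k x] tr_in[of j k y] assms by simp
qed (use assms in \<open>auto simp: direct_union_rel_def\<close>)

lemma direct_union_equiv: "equiv (SIGMA i:I. mspace (T i)) (direct_union_rel I T \<psi>)"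
proof (rule equivI)
  show "direct_union_rel I T \<psi> \<subseteq> (SIGMA i:I. mspace (T i)) \<times> (SIGMA i:I. mspace (T i))"
    by (auto simp: direct_union_rel_def)
  show "refl_on (SIGMA i:I. mspace (T i)) (direct_union_rel I T \<psi>)"
    by (auto simp: refl_on_def direct_union_rel_def)
  show "sym (direct_union_rel I T \<psi>)"
  proof (rule symI, clarify)
    fix i x j y assume "((i, x), (j, y)) \<in> direct_union_rel I T \<psi>"
    then obtain k where "i \<in> I" "x \<in> mspace (T i)" "j \<in> I" "y \<in> mspace (T j)"
      "k \<in> I" "i \<le> k" "j \<le> k" "transition \<psi> i k x = transition \<psi> j k y"
      unfolding direct_union_rel_def by blast
    then show "((j, y), (i, x)) \<in> direct_union_rel I T \<psi>"
      using rel_iff[of j i k y x] by simp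
  qed
  show "trans (direct_union_rel I T \<psi>)"
  proof (rule transI, clarify)
    fix i x j y k z
    assume 1: "((i, x), (j, y)) \<in> direct_union_rel I T \<psi>"
      and 2: "((j, y), (k, z)) \<in> direct_union_rel I T \<psi>"
    let ?m = "max i (max j k)"
    have in_I: "i \<in> I" "j \<in> I" "k \<in> I" "x \<in> mspace (T i)" "y \<in> mspace (T j)" "z \<in> mspace (T k)"
      using 1 2 by (auto simp: direct_union_rel_def)
    have m: "?m \<in> I" "i \<le> ?m" "j \<le> ?m" "k \<le> ?m" using in_I by (auto simp: max_def)
    show "((i, x), (k, z)) \<in> direct_union_rel I T \<psi>"
      using 1 2 rel_iff[of i j ?m x y] rel_iff[of j k ?m y z] rel_iff[of i k ?m x z] in_I m
      by simp
  qed
qed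

private lemma carrierE:
  assumes "X \<in> direct_union_carrier I T \<psi>"
  obtains i x where "i \<in> I" "x \<in> mspace (T i)" "(i, x) \<in> X"
    "X = direct_union_rel I T \<psi> `` {(i, x)}"
  using assms equiv_class_self[OF direct_union_equiv]
  unfolding direct_union_carrier_def by (auto elim!: quotientE)

private lemma in_carrier:
  assumes "i \<in> I" "x \<in> mspace (T i)"
  shows "direct_union_rel I T \<psi> `` {(i, x)} \<in> direct_union_carrier I T \<psi>"
  using assms unfolding direct_union_carrier_def by (auto intro!: quotientI)

lemma direct_union_dist_eq:
  assumes "i \<in> I" "j \<in> I" "k \<in> I" "i \<le> k" "j \<le> k" "x \<in> mspace (T i)" "y \<in> mspace (T j)"
  shows "direct_union_dist I T \<psi> (direct_union_rel I T \<psi> `` {(i, x)})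
           (direct_union_rel I T \<psi> `` {(j, y)})
         = mdist (T k) (transition \<psi> i k x) (transition \<psi> j k y)" (is "_ = ?d")
proof -
  let ?R = "direct_union_rel I T \<psi>"
  let ?P = "\<lambda>r. \<exists>i' x' j' y' k'. (i', x') \<in> ?R `` {(i, x)} \<and> (j', y') \<in> ?R `` {(j, y)} \<and>
     k' \<in> I \<and> i' \<le> k' \<and> j' \<le> k' \<and> r = mdist (T k') (transition \<psi> i' k' x') (transition \<psi> j' k' y')"
  have "?P ?d"
    using assms equiv_class_self[OF direct_union_equiv] by blast
  moreover have "r = ?d" if P: "?P r" for r
  proof -
    from P obtain i' x' j' y' k' where
      1: "((i, x), (i', x')) \<in> ?R" "((j, y), (j', y')) \<in> ?R"
      and k': "k' \<in> I" "i' \<le> k'" "j' \<le> k'"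
      and r: "r = mdist (T k') (transition \<psi> i' k' x') (transition \<psi> j' k' y')"
      by auto
    have in_I: "i' \<in> I" "j' \<in> I" "x' \<in> mspace (T i')" "y' \<in> mspace (T j')"
      using 1 by (auto simp: direct_union_rel_def)
    let ?m = "max k k'"
    have m: "?m \<in> I" "k \<le> ?m" "k' \<le> ?m" using assms k' by (auto simp: max_def)
    have le: "i \<le> ?m" "j \<le> ?m" "i' \<le> ?m" "j' \<le> ?m"
      using assms k' m by (blast intro: order_trans)+
    have "r = mdist (T ?m) (transition \<psi> i' ?m x') (transition \<psi> j' ?m y')"
      unfolding r
      using tr_dist[of k' ?m "transition \<psi> i' k' x'" "transition \<psi> j' k' y'"] tr_tr[of i' k' ?m x']
        tr_tr[of j' k' ?m y'] tr_in[of i' k' x'] tr_in[of j' k' y'] in_I k' m by simp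
    also have "transition \<psi> i' ?m x' = transition \<psi> i ?m x"
      using rel_iff[of i i' ?m x x'] 1 in_I assms m(1) le by simp
    also have "transition \<psi> j' ?m y' = transition \<psi> j ?m y"
      using rel_iff[of j j' ?m y y'] 1 in_I assms m(1) le by simp
    also have "mdist (T ?m) (transition \<psi> i ?m x) (transition \<psi> j ?m y) = ?d"
      using tr_dist[of k ?m "transition \<psi> i k x" "transition \<psi> j k y"] tr_tr[of i k ?m x]
        tr_tr[of j k ?m y] tr_in[of i k x] tr_in[of j k y] assms m by simp
    finally show ?thesis .
  qed
  ultimately have "(THE r. ?P r) = ?d" by (rule the_equality)
  then show ?thesis
    using in_carrier assms by (simp add: direct_union_dist_def)
qed

lemma Metric_space_direct_union:
  "Metric_space (direct_union_carrier I T \<psi>) (direct_union_dist I T \<psi>)"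
proof
  let ?M = "direct_union_carrier I T \<psi>" and ?d = "direct_union_dist I T \<psi>"
  let ?cl = "\<lambda>i x. direct_union_rel I T \<psi> `` {(i, x)}"
  have max_I: "i \<in> I \<Longrightarrow> j \<in> I \<Longrightarrow> max i j \<in> I" for i j by (simp add: max_def)
  have d: "?d (?cl i x) (?cl j y) =
      mdist (T (max i j)) (transition \<psi> i (max i j) x) (transition \<psi> j (max i j) y)"
    if "i \<in> I" "x \<in> mspace (T i)" "j \<in> I" "y \<in> mspace (T j)" for i x j y
    by (rule direct_union_dist_eq) (use that max_I in auto)
  show "0 \<le> ?d X Y" for X Y
  proof (cases "X \<in> ?M \<and> Y \<in> ?M")
    case True
    then have "X \<in> ?M" "Y \<in> ?M" by auto
    from carrierE[OF this(1)] carrierE[OF this(2)] obtain i x j y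
      where "X = ?cl i x" "Y = ?cl j y" "i \<in> I" "x \<in> mspace (T i)"
        "j \<in> I" "y \<in> mspace (T j)" by metis
    then show ?thesis by (simp add: d)
  qed (auto simp: direct_union_dist_def)
  show "?d X Y = ?d Y X" for X Y
  proof (cases "X \<in> ?M \<and> Y \<in> ?M")
    case True
    then have "X \<in> ?M" "Y \<in> ?M" by auto
    from carrierE[OF this(1)] carrierE[OF this(2)] obtain i x j y
      where "X = ?cl i x" "Y = ?cl j y" "i \<in> I" "x \<in> mspace (T i)"
        "j \<in> I" "y \<in> mspace (T j)" by metis
    then show ?thesis by (simp add: d mdist_commute max.commute)
  qed (auto simp: direct_union_dist_def)
  show "?d X Y = 0 \<longleftrightarrow> X = Y" if "X \<in> ?M" "Y \<in> ?M" for X Y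
  proof -
    from carrierE[OF that(1)] carrierE[OF that(2)] obtain i x j y
      where *: "X = ?cl i x" "Y = ?cl j y" "i \<in> I" "x \<in> mspace (T i)"
        "j \<in> I" "y \<in> mspace (T j)" by metis
    have "X = Y \<longleftrightarrow> ((i, x), (j, y)) \<in> direct_union_rel I T \<psi>"
      using eq_equiv_class_iff[OF direct_union_equiv, of "(i, x)" "(j, y)"] * by simp
    also have "\<dots> \<longleftrightarrow> ?d X Y = 0"
      using * rel_iff[of i j "max i j" x y] max_I[of i j] tr_in[of i "max i j" x]
        tr_in[of j "max i j" y] by (simp add: d)
    finally show ?thesis by simp
  qed
  show "?d X Z \<le> ?d X Y + ?d Y Z" if "X \<in> ?M" "Y \<in> ?M" "Z \<in> ?M" for X Y Z
  proof -
    from carrierE[OF that(1)] carrierE[OF that(2)] obtain i x j y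
      where *: "X = ?cl i x" "Y = ?cl j y" "i \<in> I" "x \<in> mspace (T i)"
        "j \<in> I" "y \<in> mspace (T j)" by metis
    from carrierE[OF that(3)] obtain k z
      where **: "Z = ?cl k z" "k \<in> I" "z \<in> mspace (T k)" by metis
    let ?m = "max i (max j k)"
    have m: "?m \<in> I" "i \<le> ?m" "j \<le> ?m" "k \<le> ?m" using * ** by (auto simp: max_def)
    have "?d X Y = mdist (T ?m) (transition \<psi> i ?m x) (transition \<psi> j ?m y)"
      unfolding *(1,2) by (rule direct_union_dist_eq) (use * m in blast)+
    moreover have "?d Y Z = mdist (T ?m) (transition \<psi> j ?m y) (transition \<psi> k ?m z)"
      unfolding *(2) **(1) by (rule direct_union_dist_eq) (use * ** m in blast)+
    moreover have "?d X Z = mdist (T ?m) (transition \<psi> i ?m x) (transition \<psi> k ?m z)"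
      unfolding *(1) **(1) by (rule direct_union_dist_eq) (use * ** m in blast)+
    moreover have "transition \<psi> i ?m x \<in> mspace (T ?m)" "transition \<psi> j ?m y \<in> mspace (T ?m)"
      "transition \<psi> k ?m z \<in> mspace (T ?m)"
      by (rule tr_in; use * ** m in blast)+
    ultimately show ?thesis
      by (simp only: mdist_triangle)
  qed
qed

end

end

theory Submission
  imports Defs
begin

text \<open>
  Points of the universal tree are coded, following Dyubina and Polterovich, by functions on a
  half-line $(-\infty, r)$ with values in a set of colours, constant near $-\infty$ and constant to
  the right of every point; two points are joined through the place where they first differ. The
  discontinuities of such a function form a well-ordered, hence countable, set of reals.
  The $\alpha$-th tree consists of the functions whose set of discontinuities has order type
  below $\omega^\alpha$. As $\omega^\alpha$ is additively indecomposable, recolouring by one of its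
  points preserves this tree, which gives homogeneity. For $\beta < \alpha$, an isometry between the
  $\beta$-th and the $\alpha$-th tree is excluded by climbing: a path is built that turns, as seen in
  the $\beta$-th tree, at a set of places of order type $\omega^\beta$, and as seen in the $\alpha$-th
  tree at no other places. It has a limit in the second tree but none in the first. The same path,
  for the identity map, shows incompleteness.
\<close>

section \<open>Left ranks of sets of reals\<close>

text \<open>Neither heights nor jump sets are metric invariants: an isometry need not fix the end at
  minus infinity, and the recolourings behind homogeneity change jump sets. Two observations restore
  enough control. A point has only one downward direction, so of two upward directions at it an
  isometry turns at most one downwards; this needs two colours besides \<open>stop\<close>, hence
  \<kappa> \<ge> 3. Along the other direction everything goes up on both sides, and after a
  translation heights agree. Where the image then changes colour is still arbitrary, but every point
  is constant for a while to the right of each place, so a climb can be stopped, and a new turn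
  begun, before the image changes colour again. Thus the rank of the jumps in the image is bounded
  by that of the climb, whose own jumps have an exactly known rank. A bound from one side suffices,
  because only an isometry from the smaller to the larger index has to be excluded and isometry is
  symmetric.\<close>

lemma countable_imp_bounded_omega1:
  fixes S :: "omega1 set"
  assumes "countable S"
  obtains b where "\<And>a. a \<in> S \<Longrightarrow> a < b"
proof -
  have "\<exists>b. \<forall>a\<in>S. a < b"
  proof (rule ccontr)
    assume "\<not> ?thesis"
    \<comment> \<open>Otherwise \<omega>1 would be a countable union of countable initial
      segments.\<close>
    then have "UNIV = (\<Union>a\<in>S. insert a {..<a})"
      by (auto simp: not_less) (metis order.order_iff_strict)
    moreover have "countable (\<Union>a\<in>S. insert a {..<a})"
      using assms countable_lessThan_omega1 by auto
    ultimately show False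
      using uncountable_omega1 by simp
  qed
  then show ?thesis
    using that by blast
qed

lemma countable_enumeration_infinitely_often:
  assumes "countable S" "S \<noteq> {}"
  obtains d :: "nat \<Rightarrow> 'a" where "\<And>n. d n \<in> S" "\<And>a N. a \<in> S \<Longrightarrow> \<exists>n\<ge>N. d n = a"
proof
  \<comment> \<open>The second coordinate of the decoded pair is ignored, so every index recurs
    infinitely often.\<close>
  let ?d = "\<lambda>n. from_nat_into S (fst (prod_decode n))"
  show "?d n \<in> S" for n by (rule from_nat_into[OF assms(2)])
  show "\<exists>n\<ge>N. ?d n = a" if "a \<in> S" for a N
  proof -
    obtain k where "from_nat_into S k = a"
      using from_nat_into_surj[OF assms(1) \<open>a \<in> S\<close>] by blast
    then show ?thesis
      using le_prod_encode_2[of N k] by (intro exI[of _ "prod_encode (k, N)"]) simp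
  qed
qed

lemma zero_le_omega1 [simp]: "0 \<le> (a :: omega1)"
  unfolding zero_omega1_def by (rule Least_le) simp

lemma not_less_zero_omega1 [simp]: "\<not> (a :: omega1) < 0"
  by (simp add: not_less)

lemma one_le_omega1_iff: "1 \<le> a \<longleftrightarrow> 0 < (a :: omega1)"
proof
  have "\<exists>a::omega1. a \<noteq> 0"
    by (metis (full_types) uncountable_omega1 countable_finite finite.emptyI finite_insert UNIV_eq_I singleton_iff)
  then have "(1::omega1) \<noteq> 0"
    unfolding one_omega1_def by (rule LeastI_ex)
  then show "1 \<le> a \<Longrightarrow> 0 < a"
    by (metis order.strict_trans2 zero_le_omega1 order.not_eq_order_implies_strict)
  show "0 < a \<Longrightarrow> 1 \<le> a"
    unfolding one_omega1_def by (rule Least_le) simp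
qed

text \<open>
  \<open>rank_le D \<alpha> t\<close> says that $D \cap (s, t)$ has order type at most $\omega^\alpha$ for some $s < t$,
  provided $D$ is well-ordered.
\<close>

inductive rank_le :: "real set \<Rightarrow> omega1 \<Rightarrow> real \<Rightarrow> bool" for D where
  rank_leI: "s < t \<Longrightarrow> D \<inter> {s<..<t} = {} \<or> (\<forall>u\<in>{s<..<t}. \<exists>\<beta><\<alpha>. rank_le D \<beta> u) \<Longrightarrow> rank_le D \<alpha> t"

lemma rank_le_gap: "s < t \<Longrightarrow> D \<inter> {s<..<t} = {} \<Longrightarrow> rank_le D \<alpha> t"
  by (rule rank_leI[OF _ disjI1])

lemma rank_le_mono:
  assumes "rank_le D \<alpha> t" "\<alpha> \<le> \<beta>" shows "rank_le D \<beta> t"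
  using assms(1)
proof cases
  case (rank_leI s)
  then show ?thesis
    using assms(2) by (intro rank_le.rank_leI[of s]) (auto dest: less_le_trans)
qed

text \<open>The rank at \<open>t\<close> sees only what lies to the left of \<open>t\<close>; this
  lets ranks be transferred between functions that agree below \<open>t\<close>.\<close>

lemma rank_le_subset: "rank_le E \<alpha> t \<Longrightarrow> D \<inter> {..<t} \<subseteq> E \<Longrightarrow> rank_le D \<alpha> t"
proof (induction rule: rank_le.induct)
  case (rank_leI s t \<alpha>)
  from rank_leI(2) show ?case
  proof
    assume "E \<inter> {s<..<t} = {}"
    with rank_leI(1) rank_leI.prems show ?thesis by (intro rank_le_gap[of s]) auto
  next
    assume *: "\<forall>u\<in>{s<..<t}. \<exists>\<beta><\<alpha>. rank_le E \<beta> u \<and> (D \<inter> {..<u} \<subseteq> E \<longrightarrow> rank_le D \<beta> u)"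
    have "D \<inter> {..<u} \<subseteq> E" if "u < t" for u
      using rank_leI.prems that by auto
    with * have "\<forall>u\<in>{s<..<t}. \<exists>\<beta><\<alpha>. rank_le D \<beta> u"
      by (metis greaterThanLessThan_iff)
    then show ?thesis
      using rank_le.rank_leI[OF rank_leI(1)] by blast
  qed
qed

text \<open>The form in which the additive indecomposability of \<omega>^\<alpha> enters: at each
  place shortly before \<open>t\<close> the larger of the two smaller ranks serves for both sets, so
  no rank is gained.\<close>

lemma rank_le_Un: "rank_le D \<alpha> t \<Longrightarrow> rank_le E \<alpha> t \<Longrightarrow> rank_le (D \<union> E) \<alpha> t"
proof (induction \<alpha> arbitrary: t rule: less_induct)
  case (less \<alpha>)
  obtain r where r: "r < t" "D \<inter> {r<..<t} = {} \<or> (\<forall>u\<in>{r<..<t}. \<exists>\<beta><\<alpha>. rank_le D \<beta> u)"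
    using less.prems(1) by cases
  obtain s where s: "s < t" "E \<inter> {s<..<t} = {} \<or> (\<forall>u\<in>{s<..<t}. \<exists>\<beta><\<alpha>. rank_le E \<beta> u)"
    using less.prems(2) by cases
  let ?m = "max r s"
  show ?case
  proof (cases "(D \<union> E) \<inter> {?m<..<t} = {}")
    case True
    then show ?thesis using r s by (intro rank_le_gap[of ?m]) auto
  next
    case False
    then have "D \<inter> {r<..<t} \<noteq> {} \<or> E \<inter> {s<..<t} \<noteq> {}"
      by auto
    \<comment> \<open>A set with an empty left neighbourhood has every rank, but some rank strictly
      below \<alpha> has to exist; the other set supplies it.\<close>
    then obtain \<beta>0 where \<beta>0: "\<beta>0 < \<alpha>"
      using r s by (metis dense greaterThanLessThan_iff)
    have D: "\<exists>\<beta><\<alpha>. rank_le D \<beta> u" and E: "\<exists>\<beta><\<alpha>. rank_le E \<beta> u" if "u \<in> {?m<..<t}" for u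
    proof -
      have "D \<inter> {r<..<t} = {} \<Longrightarrow> rank_le D \<beta>0 u"
        using that by (intro rank_le_gap[of r]) fastforce+
      then show "\<exists>\<beta><\<alpha>. rank_le D \<beta> u" using r(2) that \<beta>0 by fastforce
      have "E \<inter> {s<..<t} = {} \<Longrightarrow> rank_le E \<beta>0 u"
        using that by (intro rank_le_gap[of s]) fastforce+
      then show "\<exists>\<beta><\<alpha>. rank_le E \<beta> u" using s(2) that \<beta>0 by fastforce
    qed
    have "\<exists>\<beta><\<alpha>. rank_le (D \<union> E) \<beta> u" if u: "u \<in> {?m<..<t}" for u
    proof -
      obtain \<beta> \<gamma> where *: "\<beta> < \<alpha>" "rank_le D \<beta> u" "\<gamma> < \<alpha>" "rank_le E \<gamma> u"
        using D[OF u] E[OF u] by blast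
      have "rank_le (D \<union> E) (max \<beta> \<gamma>) u"
        using * by (intro less.IH) (auto intro: rank_le_mono)
      then show ?thesis using * by (metis max_def)
    qed
    then show ?thesis using r s by (intro rank_leI[of ?m]) auto
  qed
qed

lemma rank_le_translate: "rank_le D \<alpha> t \<Longrightarrow> rank_le ((\<lambda>x. x + c) ` D) \<alpha> (t + c)"
proof (induction rule: rank_le.induct)
  case (rank_leI s t \<alpha>)
  from rank_leI(2) show ?case
  proof
    assume "D \<inter> {s<..<t} = {}"
    with rank_leI(1) show ?thesis by (intro rank_le_gap[of "s + c"]) auto
  next
    assume *: "\<forall>u\<in>{s<..<t}. \<exists>\<beta><\<alpha>. rank_le D \<beta> u \<and> rank_le ((\<lambda>x. x + c) ` D) \<beta> (u + c)"
    have "\<exists>\<beta><\<alpha>. rank_le ((\<lambda>x. x + c) ` D) \<beta> u" if "u \<in> {s + c <..< t + c}" for u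
      using *[rule_format, of "u - c"] that by auto
    then show ?thesis
      using rank_leI(1) by (intro rank_le.rank_leI[of "s + c"]) auto
  qed
qed

text \<open>For \<open>\<alpha> > 0\<close> and a bounded well-ordered \<open>D\<close>: the order type of \<open>D\<close> is below $\omega^\alpha$.\<close>

definition rank_below :: "omega1 \<Rightarrow> real set \<Rightarrow> bool" where
  "rank_below \<alpha> D \<longleftrightarrow> (\<forall>t. \<exists>\<beta><\<alpha>. rank_le D \<beta> t)"

lemma rank_below_subset: "rank_below \<alpha> E \<Longrightarrow> D \<subseteq> E \<Longrightarrow> rank_below \<alpha> D"
  unfolding rank_below_def by (meson Int_lower1 order_trans rank_le_subset)

lemma rank_below_mono: "rank_below \<alpha> D \<Longrightarrow> \<alpha> \<le> \<beta> \<Longrightarrow> rank_below \<beta> D"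
  unfolding rank_below_def by (meson less_le_trans)

lemma rank_below_Un: 
  assumes "rank_below \<alpha> D" "rank_below \<alpha> E" shows "rank_below \<alpha> (D \<union> E)"
  unfolding rank_below_def
proof
  fix t
  obtain \<beta> \<gamma> where *: "\<beta> < \<alpha>" "rank_le D \<beta> t" "\<gamma> < \<alpha>" "rank_le E \<gamma> t"
    using assms unfolding rank_below_def by blast
  have "rank_le (D \<union> E) (max \<beta> \<gamma>) t"
    using * by (intro rank_le_Un) (auto intro: rank_le_mono)
  then show "\<exists>\<beta><\<alpha>. rank_le (D \<union> E) \<beta> t" using * by (metis max_def)
qed

lemma rank_below_translate: "rank_below \<alpha> D \<Longrightarrow> rank_below \<alpha> ((\<lambda>x. x + c) ` D)"
  unfolding rank_below_def by (metis diff_add_cancel rank_le_translate)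

lemma rank_below_singleton: 
  assumes "0 < \<alpha>" shows "rank_below \<alpha> {a}"
  unfolding rank_below_def
proof
  fix t
  have "rank_le {a} 0 t"
    by (rule rank_le_gap[of "if a < t then a else t - 1"]) auto
  then show "\<exists>\<beta><\<alpha>. rank_le {a} \<beta> t" using assms by blast
qed

lemma rank_below_insert: "0 < \<alpha> \<Longrightarrow> rank_below \<alpha> D \<Longrightarrow> rank_below \<alpha> (insert a D)"
  using rank_below_Un[OF rank_below_singleton] by simp

section \<open>Sets of reals with a gap to the right of every place\<close>

lemma right_gaps_imp_countable:
  fixes D :: "real set"
  assumes "\<And>t. \<exists>s>t. D \<inter> {t<..<s} = {}"
  shows "countable D"
proof -
  obtain s where s: "\<And>t. s t > t" "\<And>t. D \<inter> {t<..<s t} = {}"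
    using assms by metis
  obtain q where q: "\<And>t. q t \<in> \<rat>" "\<And>t. t < q t" "\<And>t. q t < s t"
    using Rats_dense_in_real[OF s(1)] by metis
  \<comment> \<open>The rational \<open>q t\<close> lies in the gap to the right of
    \<open>t\<close>, which ends no later than at the next point \<open>u\<close> of
    \<open>D\<close>.\<close>
  have "q t < q u" if "t < u" "u \<in> D" for t u
  proof -
    have "u \<notin> {t<..<s t}" using s(2) that by blast
    then show ?thesis using q(2,3)[of t] q(2)[of u] that by auto
  qed
  then have "inj_on q D"
    by (metis inj_onI less_irrefl linorder_neq_iff)
  moreover have "countable (q ` D)"
    by (rule countable_subset[OF _ countable_rat]) (use q in auto)
  ultimately show ?thesis by (rule countable_image_inj_on[rotated])
qed

text \<open>An infimum outside \<open>D\<close> would be approached from the right, where there is a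
  gap. As gaps pass to subsets, such a \<open>D\<close> is well-ordered.\<close>

lemma right_gaps_imp_has_least:
  fixes D :: "real set"
  assumes gaps: "\<And>t. \<exists>s>t. D \<inter> {t<..<s} = {}" and bdd: "bdd_below D" and "D \<noteq> {}"
  shows "Inf D \<in> D"
proof -
  obtain s where s: "s > Inf D" "D \<inter> {Inf D<..<s} = {}"
    using gaps by blast
  then obtain x where x: "x \<in> D" "x < s"
    using cInf_lessD[OF \<open>D \<noteq> {}\<close>] by blast
  then have "x = Inf D"
    using cInf_lower[OF x(1) bdd] s(2) by force
  then show ?thesis using x by simp
qed

text \<open>Places where \<open>D\<close> does not accumulate from the left have rank 0. The set
  \<open>L\<close> of the other places again has right gaps and a lower bound, so it is countable
  and well-ordered: ranks are found by induction along \<open>L\<close>, and a countable ordinal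
  exceeds them all.\<close>

lemma right_gaps_imp_rank_le:
  fixes D :: "real set"
  assumes gaps: "\<And>t. \<exists>s>t. D \<inter> {t<..<s} = {}" and bdd: "bdd_below D"
  obtains \<alpha> where "\<And>t. rank_le D \<alpha> t"
proof -
  define L where "L = {t. \<forall>s<t. D \<inter> {s<..<t} \<noteq> {}}"
  have LI: "D \<inter> {s<..<t} = {} \<Longrightarrow> s < t \<Longrightarrow> t \<notin> L" for s t
    unfolding L_def by blast
  have notL: "t \<notin> L \<Longrightarrow> \<exists>s<t. D \<inter> {s<..<t} = {}" for t
    unfolding L_def by blast
  have gapsL: "\<exists>s>t. L \<inter> {t<..<s} = {}" for t
  proof -
    obtain s where s: "s > t" "D \<inter> {t<..<s} = {}" using gaps by blast
    have "u \<notin> L" if "u \<in> {t<..<s}" for u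
    proof -
      have "D \<inter> {t<..<u} = {}" using s that by fastforce
      then show ?thesis using LI[of t u] that by simp
    qed
    then show ?thesis using s(1) by blast
  qed
  obtain l where l: "\<And>d. d \<in> D \<Longrightarrow> l \<le> d"
    using bdd unfolding bdd_below_def by blast
  have "l \<le> t" if "t \<in> L" for t
  proof -
    have "D \<inter> {t - 1<..<t} \<noteq> {}" using LI[of "t - 1" t] that by auto
    then show ?thesis using l by fastforce
  qed
  then have bddL: "bdd_below L" by (rule bdd_belowI)
  \<comment> \<open>Used twice: for the singleton of a least bad place, then for all reals to get
    one uniform bound.\<close>
  have step: "\<exists>\<alpha>. \<forall>t\<in>T. rank_le D \<alpha> t"
    if pos: "\<And>u t. t \<in> T \<Longrightarrow> u < t \<Longrightarrow> u \<in> L \<Longrightarrow> \<exists>\<alpha>. rank_le D \<alpha> u" for T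
  proof -
    define r where "r u = (SOME \<alpha>. rank_le D \<alpha> u)" for u
    have r: "rank_le D (r u) u" if "t \<in> T" "u < t" "u \<in> L" for u t
      unfolding r_def using pos[OF that] by (rule someI_ex)
    \<comment> \<open>The 0 makes the bound positive, so that rank 0 is strictly below it at the
      places outside \<open>L\<close>.\<close>
    have "countable (insert 0 (r ` L))"
      using right_gaps_imp_countable[OF gapsL] by simp
    then obtain b where b: "\<And>a. a \<in> insert 0 (r ` L) \<Longrightarrow> a < b"
      by (rule countable_imp_bounded_omega1) (rule that)
    have "rank_le D b t" if "t \<in> T" for t
    proof (rule rank_leI[of "t - 1"])
      have "\<exists>\<beta><b. rank_le D \<beta> u" if "u < t" for u
      proof (cases "u \<in> L")
        case True
        then have "rank_le D (r u) u" "r u < b" using r[OF \<open>t \<in> T\<close> that] b by blast+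
        then show ?thesis by blast
      next
        case False
        then obtain s where "s < u" "D \<inter> {s<..<u} = {}" using notL by blast
        then show ?thesis using b[of 0] rank_le_gap[of s u D 0] by blast
      qed
      then show "D \<inter> {t - 1<..<t} = {} \<or> (\<forall>u\<in>{t - 1<..<t}. \<exists>\<beta><b. rank_le D \<beta> u)" by simp
    qed simp
    then show ?thesis by blast
  qed
  have good: "\<exists>\<alpha>. rank_le D \<alpha> u" if "u \<in> L" for u
  proof (rule ccontr)
    assume bad: "\<not> ?thesis"
    define B where "B = {u \<in> L. \<not> (\<exists>\<alpha>. rank_le D \<alpha> u)}"
    have bddB: "bdd_below B" using bddL by (rule bdd_below_mono) (auto simp: B_def)
    have "Inf B \<in> B"
    proof (rule right_gaps_imp_has_least[OF _ bddB])
      show "\<exists>s>t. B \<inter> {t<..<s} = {}" for t using gapsL[of t] B_def by blast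
      show "B \<noteq> {}" using bad that B_def by blast
    qed
    moreover have "\<exists>\<alpha>. \<forall>t\<in>{Inf B}. rank_le D \<alpha> t"
    proof (rule step)
      fix u t assume "t \<in> {Inf B}" "u < t" "u \<in> L"
      then have "u \<notin> B" using cInf_lower[OF _ bddB, of u] by auto
      with \<open>u \<in> L\<close> B_def show "\<exists>\<alpha>. rank_le D \<alpha> u" by simp
    qed
    ultimately show False by (simp add: B_def)
  qed
  have "\<exists>\<alpha>. \<forall>t\<in>UNIV. rank_le D \<alpha> t"
    by (rule step) (rule good)
  then show ?thesis using that by blast
qed

section \<open>The universal tree\<close>

text \<open>
  The colours are the elements of \<open>K\<close> other than \<open>stop\<close>, which marks the complement of the
  half-line. This makes \<open>K\<close> itself the index set of the directions at a point: \<open>stop\<close> stands for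
  the direction towards $-\infty$.
\<close>

locale coded_tree =
  fixes K :: "'k set" and stop base other :: 'k
  assumes K: "stop \<in> K" "base \<in> K" "other \<in> K"
    and distinct: "base \<noteq> stop" "other \<noteq> stop" "other \<noteq> base"
begin

text \<open>Constancy on the right, rather than on the left, makes distinct points differ at the
  very place where they part and makes the discontinuities well-ordered. The common colour near
  minus infinity makes any two points agree somewhere.\<close>

definition points :: "(real \<Rightarrow> 'k) set" where
  "points = {f. range f \<subseteq> K \<and> (\<exists>r. \<forall>t. f t = stop \<longleftrightarrow> r \<le> t) \<and>
     (\<forall>t. \<exists>s>t. \<forall>u\<in>{t..<s}. f u = f t) \<and> (\<exists>l. \<forall>t<l. f t = base)}"

text \<open>A Busemann function of the end at minus infinity, increasing away from it.\<close>

definition height :: "(real \<Rightarrow> 'k) \<Rightarrow> real" where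
  "height f = Inf {t. f t = stop}"

lemma height_eqI: "(\<And>t. f t = stop \<longleftrightarrow> r \<le> t) \<Longrightarrow> height f = r"
  unfolding height_def using cInf_atLeast[of r] by (simp add: atLeast_def)

lemma stop_iff:
  assumes "f \<in> points" shows "f t = stop \<longleftrightarrow> height f \<le> t"
proof -
  obtain r where r: "\<And>t. f t = stop \<longleftrightarrow> r \<le> t"
    using assms unfolding points_def by blast
  with height_eqI[OF r] show ?thesis by simp
qed

lemma points_right_const:
  assumes "f \<in> points"
  obtains s where "s > t" "\<And>u. t \<le> u \<Longrightarrow> u < s \<Longrightarrow> f u = f t"
proof -
  have "\<exists>s>t. \<forall>u\<in>{t..<s}. f u = f t"
    using assms unfolding points_def by blast
  then show ?thesis using that by (metis atLeastLessThan_iff)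
qed

lemma points_base:
  assumes "f \<in> points"
  obtains l where "\<And>t. t < l \<Longrightarrow> f t = base"
  using assms unfolding points_def by blast

lemma points_in_K: "f \<in> points \<Longrightarrow> f t \<in> K"
  by (auto simp: points_def)

lemma pointsI:
  assumes "\<And>t. f t \<in> K" "\<And>t. f t = stop \<longleftrightarrow> r \<le> t"
    "\<And>t. t < r \<Longrightarrow> \<exists>s>t. \<forall>u. t \<le> u \<and> u < s \<longrightarrow> f u = f t" "\<And>t. t < l \<Longrightarrow> f t = base"
  shows "f \<in> points"
proof -
  have "\<exists>s>t. \<forall>u\<in>{t..<s}. f u = f t" for t
  proof (cases "t < r")
    case True
    then obtain s where "s > t" "\<forall>u. t \<le> u \<and> u < s \<longrightarrow> f u = f t" using assms(3) by blast
    then show ?thesis by (metis atLeastLessThan_iff)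
  next
    case False
    then have "f u = f t" if "u \<in> {t..<t+1}" for u
      using assms(2)[THEN iffD2, of t] assms(2)[THEN iffD2, of u] that by simp
    then show ?thesis using less_add_one by blast
  qed
  moreover have "range f \<subseteq> K" using assms(1) by (rule image_subsetI)
  moreover have "\<exists>r. \<forall>t. f t = stop \<longleftrightarrow> r \<le> t" by (intro exI allI) (rule assms(2))
  moreover have "\<exists>l. \<forall>t<l. f t = base" by (intro exI allI impI) (rule assms(4))
  ultimately show ?thesis
    unfolding points_def by simp
qed

section \<open>Truncation, first differences and the distance\<close>

definition cut :: "(real \<Rightarrow> 'k) \<Rightarrow> real \<Rightarrow> real \<Rightarrow> 'k" where
  "cut f t = (\<lambda>s. if s < t then f s else stop)"

lemma cut_in_points: 
  assumes "f \<in> points" "t \<le> height f" shows "cut f t \<in> points"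
proof -
  obtain l where l: "\<And>t. t < l \<Longrightarrow> f t = base" using points_base[OF assms(1)] by blast
  show ?thesis
  proof (rule pointsI[of _ t "min l t"])
    show "cut f t u \<in> K" for u using points_in_K[OF assms(1)] K by (simp add: cut_def)
    show "cut f t u = stop \<longleftrightarrow> t \<le> u" for u using stop_iff[OF assms(1)] assms(2) by (auto simp: cut_def)
    show "\<exists>s>u. \<forall>v. u \<le> v \<and> v < s \<longrightarrow> cut f t v = cut f t u" if "u < t" for u
    proof -
      obtain s where "s > u" "\<And>v. u \<le> v \<Longrightarrow> v < s \<Longrightarrow> f v = f u" using points_right_const[OF assms(1)] by blast
      then have "cut f t v = cut f t u" if "u \<le> v" "v < min s t" for v
        using that \<open>u < t\<close> unfolding cut_def by (metis min_less_iff_conj)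
      then show ?thesis using \<open>s > u\<close> \<open>u < t\<close> by (metis min_less_iff_conj)
    qed
    show "u < min l t \<Longrightarrow> cut f t u = base" for u using l by (simp add: cut_def)
  qed
qed

lemma height_cut: "f \<in> points \<Longrightarrow> t \<le> height f \<Longrightarrow> height (cut f t) = t"
  by (rule height_eqI) (auto simp: cut_def stop_iff)

lemma cut_height [simp]: "f \<in> points \<Longrightarrow> cut f (height f) = f"
  by (auto simp: cut_def fun_eq_iff not_less stop_iff[THEN iffD2])

lemma cut_cut: "s \<le> t \<Longrightarrow> cut (cut f t) s = cut f s"
  by (auto simp: cut_def fun_eq_iff)

text \<open>The Gromov product relative to the end at minus infinity. The caps by the heights keep
  the set bounded when \<open>f = g\<close>.\<close>

definition meet :: "(real \<Rightarrow> 'k) \<Rightarrow> (real \<Rightarrow> 'k) \<Rightarrow> real" where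
  "meet f g = Sup {t. t \<le> height f \<and> t \<le> height g \<and> (\<forall>s<t. f s = g s)}"

text \<open>The supremum is attained because agreement is required only strictly below
  \<open>t\<close>. Most facts about \<open>meet\<close> are read off from this equivalence.\<close>

lemma le_meet_iff:
  assumes "f \<in> points" "g \<in> points"
  shows "t \<le> meet f g \<longleftrightarrow> t \<le> height f \<and> t \<le> height g \<and> (\<forall>s<t. f s = g s)"
proof -
  let ?S = "{t. t \<le> height f \<and> t \<le> height g \<and> (\<forall>s<t. f s = g s)}"
  obtain l where l: "\<And>t. t < l \<Longrightarrow> f t = base" using points_base[OF assms(1)] by blast
  obtain l' where l': "\<And>t. t < l' \<Longrightarrow> g t = base" using points_base[OF assms(2)] by blast
  have "min (min l l') (min (height f) (height g)) \<in> ?S"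
    using l l' by auto
  then have ne: "?S \<noteq> {}" by blast
  have bdd: "bdd_above ?S" by (rule bdd_aboveI[of _ "height f"]) auto
  have 1: "t \<le> meet f g" if "t \<in> ?S"
    unfolding meet_def by (rule cSup_upper[OF that bdd])
  have "meet f g \<le> height f" "meet f g \<le> height g"
    unfolding meet_def by (rule cSup_least[OF ne]; simp)+
  moreover have "f s = g s" if s: "s < meet f g" for s
    using less_cSupD[OF ne s[unfolded meet_def]] by blast
  ultimately have "t \<in> ?S" if "t \<le> meet f g"
    using that by simp
  with 1 show ?thesis by blast
qed

lemma meet_commute: "meet f g = meet g f"
  unfolding meet_def by (simp add: eq_commute conj_left_commute)

lemma meet_le: "f \<in> points \<Longrightarrow> g \<in> points \<Longrightarrow> meet f g \<le> height f"
    "f \<in> points \<Longrightarrow> g \<in> points \<Longrightarrow> meet f g \<le> height g"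
  using le_meet_iff[of f g "meet f g"] by simp_all

lemma meet_agree: "f \<in> points \<Longrightarrow> g \<in> points \<Longrightarrow> s < meet f g \<Longrightarrow> f s = g s"
  using le_meet_iff[of f g "meet f g"] by simp

lemma meet_self: "f \<in> points \<Longrightarrow> meet f f = height f"
  using le_meet_iff[of f f "height f"] meet_le(1)[of f f] by simp

text \<open>The 0-hyperbolic inequality: it yields the triangle inequality and the tree
  structure.\<close>

lemma meet_ultra: 
  assumes "f \<in> points" "g \<in> points" "h \<in> points"
  shows "min (meet f g) (meet g h) \<le> meet f h"
proof -
  let ?m = "min (meet f g) (meet g h)"
  have "?m \<le> height f" "?m \<le> height h"
    using meet_le[of f g] meet_le[of g h] assms by linarith+
  moreover have "f s = h s" if "s < ?m" for s
    using meet_agree[of f g s] meet_agree[of g h s] assms that by simp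
  ultimately show ?thesis by (simp add: le_meet_iff assms)
qed

text \<open>Agreement at the meet would continue to its right by right constancy, against
  maximality; if the common value is \<open>stop\<close>, both functions have ended and
  coincide.\<close>

lemma meet_differ:
  assumes "f \<in> points" "g \<in> points" "f \<noteq> g"
  shows "f (meet f g) \<noteq> g (meet f g)"
proof
  let ?m = "meet f g"
  assume eq: "f ?m = g ?m"
  show False
  proof (cases "f ?m = stop")
    case True
    then have "height f \<le> ?m" "height g \<le> ?m"
      using stop_iff[OF assms(1), of ?m] stop_iff[OF assms(2), of ?m] eq by simp_all
    then have "f t = g t" for t
      using meet_agree[OF assms(1,2), of t] stop_iff[OF assms(1), of t] stop_iff[OF assms(2), of t]
      by (cases "t < ?m") auto
    then have "f = g" by blast
    with assms(3) show False ..
  next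
    case False
    obtain r where r: "r > ?m" "\<And>u. ?m \<le> u \<Longrightarrow> u < r \<Longrightarrow> f u = f ?m"
      using points_right_const[OF assms(1)] by blast
    obtain s where s: "s > ?m" "\<And>u. ?m \<le> u \<Longrightarrow> u < s \<Longrightarrow> g u = g ?m"
      using points_right_const[OF assms(2)] by blast
    obtain t where t: "?m < t" "t < min r s"
      using r(1) s(1) dense[of ?m "min r s"] by auto
    have "t \<le> height f" "t \<le> height g"
      using r(2)[of t] s(2)[of t] t False eq stop_iff[OF assms(1), of t] stop_iff[OF assms(2), of t] by auto
    moreover have "f u = g u" if "u < t" for u
      using meet_agree[OF assms(1,2), of u] r(2)[of u] s(2)[of u] eq t that by (cases "u < ?m") auto
    ultimately have "t \<le> ?m" using le_meet_iff[OF assms(1,2)] by blast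
    with t show False by simp
  qed
qed

lemma meet_cut:
  assumes "f \<in> points" "g \<in> points" "s \<le> height f" "t \<le> height g"
  shows "meet (cut f s) (cut g t) = min (min s t) (meet f g)"
proof -
  have "x \<le> meet (cut f s) (cut g t) \<longleftrightarrow> x \<le> min (min s t) (meet f g)" for x
    using assms by (auto simp: le_meet_iff cut_in_points height_cut) (auto simp: cut_def)
  from this[of "meet (cut f s) (cut g t)"] this[of "min (min s t) (meet f g)"]
  show ?thesis by (simp only: order_refl order_antisym)
qed

text \<open>The value 0 off \<open>points\<close> makes symmetry and nonnegativity hold for all
  arguments, as the locale \<open>Metric_space\<close> requires.\<close>

definition tree_dist :: "(real \<Rightarrow> 'k) \<Rightarrow> (real \<Rightarrow> 'k) \<Rightarrow> real" where
  "tree_dist f g = (if f \<in> points \<and> g \<in> points then height f + height g - 2 * meet f g else 0)"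

lemma tree_dist_eq: "f \<in> points \<Longrightarrow> g \<in> points \<Longrightarrow> tree_dist f g = height f + height g - 2 * meet f g"
  by (simp add: tree_dist_def)

lemma Metric_space_points: "Metric_space points tree_dist"
proof
  show "0 \<le> tree_dist f g" for f g
    using meet_le[of f g] by (auto simp: tree_dist_def)
  show "tree_dist f g = tree_dist g f" for f g
    by (auto simp: tree_dist_def meet_commute)
  show "tree_dist f g = 0 \<longleftrightarrow> f = g" if *: "f \<in> points" "g \<in> points" for f g
  proof
    assume "tree_dist f g = 0"
    then have m: "meet f g = height f" "meet f g = height g"
      using meet_le[OF *] by (simp_all add: tree_dist_eq *)
    then have "f (meet f g) = stop" "g (meet f g) = stop"
      using stop_iff[OF *(1)] stop_iff[OF *(2)] by simp_all
    then show "f = g"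
      using meet_differ[OF *] by auto
  qed (simp add: tree_dist_eq * meet_self)
  show "tree_dist f h \<le> tree_dist f g + tree_dist g h"
    if "f \<in> points" "g \<in> points" "h \<in> points" for f g h
    using that meet_ultra[OF that] meet_le[of f g] meet_le[of g h] by (auto simp: tree_dist_eq)
qed

definition tree :: "(real \<Rightarrow> 'k) set \<Rightarrow> (real \<Rightarrow> 'k) metric" where
  "tree A = metric (A, tree_dist)"

context
  fixes A assumes A: "A \<subseteq> points"
begin

lemma Metric_space_tree: "Metric_space A tree_dist"
  using Metric_space.subspace[OF Metric_space_points A] .

lemma mspace_tree [simp]: "mspace (tree A) = A"
  unfolding tree_def by (rule Metric_space.mspace_metric[OF Metric_space_tree])

lemma mdist_tree [simp]: "mdist (tree A) = tree_dist"
  unfolding tree_def by (rule Metric_space.mdist_metric[OF Metric_space_tree])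

end

section \<open>Directions and arcs\<close>

text \<open>Argument order: in \<open>extends f g\<close> it is \<open>g\<close> that prolongs \<open>f\<close>.\<close>

definition extends :: "(real \<Rightarrow> 'k) \<Rightarrow> (real \<Rightarrow> 'k) \<Rightarrow> bool" where
  "extends f g \<longleftrightarrow> (\<forall>s<height f. f s = g s)"

lemma extends_height_le:
  assumes "f \<in> points" "g \<in> points" "extends f g" shows "height f \<le> height g"
proof (rule ccontr)
  assume "\<not> ?thesis"
  then have "f (height g) = g (height g)" using assms(3) by (simp add: extends_def)
  then have "height f \<le> height g" using stop_iff[OF assms(1), of "height g"] stop_iff[OF assms(2), of "height g"] by simp
  with \<open>\<not> ?thesis\<close> show False by simp
qed

lemma extends_iff_meet: "f \<in> points \<Longrightarrow> g \<in> points \<Longrightarrow> extends f g \<longleftrightarrow> meet f g = height f"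
  using extends_height_le[of f g] le_meet_iff[of f g "height f"] meet_le(1)[of f g]
  by (auto simp: extends_def)

lemma extends_iff_cut: "f \<in> points \<Longrightarrow> g \<in> points \<Longrightarrow> extends f g \<longleftrightarrow> f = cut g (height f)"
  unfolding extends_def by (auto simp: cut_def fun_eq_iff not_less stop_iff[THEN iffD2])

lemma extends_cut: "f \<in> points \<Longrightarrow> t \<le> height f \<Longrightarrow> extends (cut f t) f"
  by (auto simp: extends_def height_cut) (simp add: cut_def)

lemma extends_trans: "f \<in> points \<Longrightarrow> g \<in> points \<Longrightarrow> extends f g \<Longrightarrow> extends g h \<Longrightarrow> extends f h"
  using extends_height_le[of f g] by (auto simp: extends_def)

lemma extends_refl [simp]: "extends f f"
  by (simp add: extends_def)

text \<open>Both paths leave \<open>f\<close> downwards, so they share a segment and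
  \<open>f\<close> is not between the end points.\<close>

lemma tree_dist_less_add:
  assumes "f \<in> points" "g \<in> points" "h \<in> points" "\<not> extends f g" "\<not> extends f h"
  shows "tree_dist g h < tree_dist g f + tree_dist f h"
proof -
  have "meet g f < height f" "meet f h < height f"
    using assms extends_iff_meet[of f g] extends_iff_meet[of f h] meet_le(1)[of f g] meet_le(1)[of f h]
    by (simp_all add: meet_commute order.strict_iff_order)
  then show ?thesis
    using meet_ultra[of g f h] assms by (simp add: tree_dist_eq)
qed

text \<open>Names the direction at \<open>f\<close> that contains \<open>g\<close>, for
  \<open>g \<noteq> f\<close>; \<open>stop\<close> stands for the direction downwards.\<close>

definition label :: "(real \<Rightarrow> 'k) \<Rightarrow> (real \<Rightarrow> 'k) \<Rightarrow> 'k" where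
  "label f g = (if extends f g then g (height f) else stop)"

lemma label_stop_iff:
  assumes "f \<in> points" "g \<in> points" "g \<noteq> f"
  shows "label f g = stop \<longleftrightarrow> \<not> extends f g"
proof -
  have "height f < height g" if "extends f g"
  proof -
    have "height f \<noteq> height g"
    proof
      assume "height f = height g"
      then have "f = cut g (height g)" using that assms extends_iff_cut by metis
      then show False using assms by simp
    qed
    then show ?thesis using extends_height_le[OF assms(1,2) that] by simp
  qed
  then show ?thesis
    using assms stop_iff[of g "height f"] by (auto simp: label_def)
qed

text \<open>If both points extend \<open>f\<close>, the labels decide whether they part at
  \<open>f\<close> or later; if only one does, the path between them passes through
  \<open>f\<close>; if neither does, both paths from \<open>f\<close> start downwards. Labels thus
  become betweenness, the metric relation on which the arguments about arcs and directions
  rest.\<close>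

lemma label_neq_iff:
  assumes P: "f \<in> points" "g \<in> points" "h \<in> points" and ne: "g \<noteq> f" "h \<noteq> f"
  shows "label f g \<noteq> label f h \<longleftrightarrow> tree_dist g h = tree_dist g f + tree_dist f h"
proof -
  have mc: "meet g f = meet f g" by (rule meet_commute)
  have *: "tree_dist g h = tree_dist g f + tree_dist f h" 
    if "extends f g" "\<not> extends f h" "g \<in> points" "h \<in> points" for g h
  proof -
    have mg: "meet f g = height f" using that P extends_iff_meet by blast
    have mh: "meet f h < height f" using that P(1) extends_iff_meet[of f h] meet_le(1)[of f h] by force
    show ?thesis
      using meet_ultra[of g f h] meet_ultra[of f g h] that P mg mh
      by (simp add: tree_dist_eq meet_commute[of g f])
  qed
  consider "extends f g" "extends f h" | "extends f g" "\<not> extends f h"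
    | "\<not> extends f g" "extends f h" | "\<not> extends f g" "\<not> extends f h" by blast
  then show ?thesis
  proof cases
    case 1
    then have m: "meet f g = height f" "meet f h = height f"
      using P extends_iff_meet by blast+
    then have le: "height f \<le> meet g h"
      using meet_ultra[of g f h] P by (simp add: mc)
    have "label f g \<noteq> label f h \<longleftrightarrow> g (height f) \<noteq> h (height f)"
      using 1 by (simp add: label_def)
    also have "\<dots> \<longleftrightarrow> meet g h = height f"
    proof
      assume "g (height f) \<noteq> h (height f)"
      then show "meet g h = height f"
        using le meet_agree[OF P(2,3), of "height f"] by fastforce
    next
      assume eq: "meet g h = height f"
      show "g (height f) \<noteq> h (height f)"
      proof (cases "g = h")
        case True
        then have "height g = height f" using eq meet_self P by simp
        then have "f = cut g (height g)" using 1(1) extends_iff_cut P by metis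
        then have "f = g" using P(2) by simp
        then show ?thesis using ne by simp
      next
        case False
        then show ?thesis using meet_differ[OF P(2,3)] eq by simp
      qed
    qed
    also have "\<dots> \<longleftrightarrow> tree_dist g h = tree_dist g f + tree_dist f h"
      using m P by (auto simp: tree_dist_eq mc)
    finally show ?thesis .
  next
    case 2
    then show ?thesis using *[of g h] P ne label_stop_iff by metis
  next
    case 3
    have comm: "tree_dist x y = tree_dist y x" for x y by (rule Metric_space.commute[OF Metric_space_points])
    show ?thesis using 3 *[of h g] P ne label_stop_iff comm by (metis add.commute)
  next
    case 4
    then show ?thesis using tree_dist_less_add[of f g h] P by (simp add: label_def)
  qed
qed


lemma tree_dist_commute: "tree_dist f g = tree_dist g f"
  by (rule Metric_space.commute[OF Metric_space_points])

lemma tree_dist_nonneg: "0 \<le> tree_dist f g"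
  by (rule Metric_space.nonneg[OF Metric_space_points])

lemma tree_dist_pos: "f \<in> points \<Longrightarrow> g \<in> points \<Longrightarrow> f \<noteq> g \<Longrightarrow> 0 < tree_dist f g"
  using tree_dist_nonneg[of f g] Metric_space.zero[OF Metric_space_points, of f g] by linarith

lemma meet_cut_right:
  assumes "f \<in> points" "g \<in> points" "t \<le> height g"
  shows "meet f (cut g t) = min t (meet f g)"
  using meet_cut[OF assms(1,2) order_refl assms(3)] meet_le(1)[OF assms(1,2)] assms(1) by simp

section \<open>Completeness of the universal tree\<close>

lemma glue:
  assumes G: "\<And>t. t < r \<Longrightarrow> G t \<in> points" "\<And>t. t < r \<Longrightarrow> t < height (G t)"
    and compat: "\<And>s t u. s \<le> t \<Longrightarrow> t < r \<Longrightarrow> u \<le> s \<Longrightarrow> G s u = G t u"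
  obtains g where "g \<in> points" "height g = r" "\<And>t u. t < r \<Longrightarrow> u \<le> t \<Longrightarrow> g u = G t u"
proof -
  define g where "g t = (if t < r then G t t else stop)" for t
  have g: "g u = G t u" if "t < r" "u \<le> t" for t u
    using that compat[of u t u] by (simp add: g_def)
  have stop: "g t = stop \<longleftrightarrow> r \<le> t" for t
    using stop_iff[OF G(1), of t t] G(2)[of t] by (auto simp: g_def)
  obtain l where l: "\<And>t. t < l \<Longrightarrow> G (r - 1) t = base"
    using points_base[OF G(1), of "r - 1"] by auto
  have "g \<in> points"
  proof (rule pointsI)
    show "g t \<in> K" for t using points_in_K[OF G(1)] K by (simp add: g_def)
    show "g t = stop \<longleftrightarrow> r \<le> t" for t by (rule stop)
    show "\<exists>s>t. \<forall>u. t \<le> u \<and> u < s \<longrightarrow> g u = g t" if "t < r" for t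
    proof -
      obtain w where w: "t < w" "w < r" using dense[OF \<open>t < r\<close>] by blast
      obtain s where s: "s > t" "\<And>u. t \<le> u \<Longrightarrow> u < s \<Longrightarrow> G w u = G w t"
        using points_right_const[OF G(1)[OF w(2)]] by blast
      have eq: "g u = g t" if "t \<le> u" "u < min s w" for u
        using g[OF w(2), of u] g[OF w(2), of t] s(2)[OF that(1)] that w(1) by simp
      show ?thesis
        by (intro exI[of _ "min s w"] conjI allI impI) (use s(1) w(1) eq in \<open>simp, blast\<close>)
    qed
    show "g t = base" if "t < min l (r - 1)" for t
      using g[of "r - 1" t] l[of t] that by simp
  qed
  moreover have "height g = r" by (rule height_eqI) (rule stop)
  ultimately show ?thesis using that g by blast
qed

lemma height_diff_le_tree_dist:
  assumes "f \<in> points" "g \<in> points"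
  shows "\<bar>height f - height g\<bar> \<le> tree_dist f g"
  using meet_le[OF assms] by (simp add: tree_dist_eq assms)

lemma mcomplete_points: "Metric_space.mcomplete points tree_dist"
proof -
  interpret P: Metric_space points tree_dist by (rule Metric_space_points)
  have "\<exists>g. limitin P.mtopology \<sigma> g sequentially" if "P.MCauchy \<sigma>" for \<sigma>
  proof -
    have p: "\<sigma> n \<in> points" for n using that unfolding P.MCauchy_def by blast
    have cau: "\<exists>N. \<forall>m\<ge>N. \<forall>n\<ge>N. tree_dist (\<sigma> m) (\<sigma> n) < e" if "e > 0" for e
      using \<open>P.MCauchy \<sigma>\<close> that unfolding P.MCauchy_def by meson
    have "Cauchy (\<lambda>n. height (\<sigma> n))"
      unfolding Cauchy_def dist_real_def using cau height_diff_le_tree_dist[OF p p] by (meson le_less_trans)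
    then obtain r where r: "(\<lambda>n. height (\<sigma> n)) \<longlonglongrightarrow> r"
      using Cauchy_convergent convergent_def by blast
    \<comment> \<open>Heights near \<open>r\<close> and small mutual distances force the late
      members of the sequence to agree up to any \<open>t < r\<close>.\<close>
    have ev: "\<exists>N. \<forall>m\<ge>N. \<forall>n\<ge>N. t < meet (\<sigma> m) (\<sigma> n)" if "t < r" for t
    proof -
      define e where "e = (r - t) / 2"
      have e: "e > 0" using that by (simp add: e_def)
      obtain N where N: "\<And>m n. m \<ge> N \<Longrightarrow> n \<ge> N \<Longrightarrow> tree_dist (\<sigma> m) (\<sigma> n) < e" using cau[OF e] by blast
      obtain N' where N': "\<And>n. n \<ge> N' \<Longrightarrow> \<bar>height (\<sigma> n) - r\<bar> < e"
        using r e unfolding LIMSEQ_def dist_real_def by blast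
      have "t < meet (\<sigma> m) (\<sigma> n)" if "m \<ge> max N N'" "n \<ge> max N N'" for m n
      proof -
        have "tree_dist (\<sigma> m) (\<sigma> n) < e" "\<bar>height (\<sigma> m) - r\<bar> < e" "\<bar>height (\<sigma> n) - r\<bar> < e"
          using that N N' by simp_all
        moreover have "2 * e = r - t" by (simp add: e_def)
        ultimately show ?thesis using e unfolding tree_dist_eq[OF p p] by linarith
      qed
      then show ?thesis by blast
    qed
    then obtain N where N: "\<And>t m n. t < r \<Longrightarrow> m \<ge> N t \<Longrightarrow> n \<ge> N t \<Longrightarrow> t < meet (\<sigma> m) (\<sigma> n)"
      by metis
    obtain g where g: "g \<in> points" "height g = r" "\<And>t u. t < r \<Longrightarrow> u \<le> t \<Longrightarrow> g u = \<sigma> (N t) u"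
    proof (rule glue[of r "\<lambda>t. \<sigma> (N t)"])
      show "t < height (\<sigma> (N t))" if "t < r" for t
        using N[OF that order_refl order_refl] meet_le(1)[OF p p] by (rule less_le_trans)
      show "\<sigma> (N s) u = \<sigma> (N t) u" if "s \<le> t" "t < r" "u \<le> s" for s t u
      proof -
        let ?M = "max (N s) (N t)"
        have "u < meet (\<sigma> (N s)) (\<sigma> ?M)" "u < meet (\<sigma> (N t)) (\<sigma> ?M)"
          using N[of s "N s" ?M] N[of t "N t" ?M] that by auto
        then show ?thesis using meet_agree[OF p p] by metis
      qed
    qed (use p in auto)
    have "\<exists>M. \<forall>n\<ge>M. \<sigma> n \<in> points \<and> tree_dist (\<sigma> n) g < e" if e: "e > 0" for e
    proof -
      \<comment> \<open>The meet enters the distance twice, so \<open>e / 4\<close> there and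
        \<open>e / 2\<close> from the height add up to \<open>e\<close>.\<close>
      define t where "t = r - e / 4"
      have t: "t < r" using e by (simp add: t_def)
      have "e / 2 > 0" using e by simp
      then obtain M where M: "\<And>n. n \<ge> M \<Longrightarrow> \<bar>height (\<sigma> n) - r\<bar> < e / 2"
        using r unfolding LIMSEQ_def dist_real_def by blast
      have "tree_dist (\<sigma> n) g < e" if "n \<ge> max M (N t)" for n
      proof -
        have n: "n \<ge> M" "n \<ge> N t" using that by auto
        have a: "t < meet (\<sigma> n) (\<sigma> (N t))" using N[OF t n(2) order_refl] .
        have "t \<le> meet (\<sigma> n) g"
          unfolding le_meet_iff[OF p g(1)]
        proof (intro conjI allI impI)
          show "t \<le> height (\<sigma> n)" using a meet_le(1)[OF p p, of n "N t"] by simp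
          show "t \<le> height g" using t g(2) by simp
          show "\<sigma> n s = g s" if "s < t" for s
            using meet_agree[OF p p, of s n "N t"] a g(3)[OF t, of s] that by simp
        qed
        then show ?thesis using M[OF n(1)] g(2) unfolding tree_dist_eq[OF p g(1)] t_def by linarith
      qed
      then show ?thesis using p by blast
    qed
    then show ?thesis using g(1) unfolding P.limit_metric_sequentially by blast
  qed
  then show ?thesis unfolding P.mcomplete_def by blast
qed

text \<open>This condition suffices for convexity, since geodesics consist of truncations of their
  end points.\<close>

definition cut_closed :: "(real \<Rightarrow> 'k) set \<Rightarrow> bool" where
  "cut_closed A \<longleftrightarrow> (\<forall>f\<in>A. \<forall>t\<le>height f. cut f t \<in> A)"

text \<open>The paths to \<open>h\<close> from two points in the same direction share a final piece,
  and \<open>p\<close> is taken from it: the place where \<open>f\<close> and \<open>g\<close> part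
  if they lie above \<open>h\<close>, and a truncation of \<open>h\<close> otherwise.\<close>

lemma median:
  assumes A: "A \<subseteq> points" "cut_closed A" and m: "f \<in> A" "g \<in> A" "h \<in> A"
    and ne: "f \<noteq> h" "g \<noteq> h" and lab: "label h f = label h g"
  obtains p where "p \<in> A" "p \<noteq> h" "tree_dist f h = tree_dist f p + tree_dist p h"
    "tree_dist h g = tree_dist h p + tree_dist p g"
proof -
  have P: "f \<in> points" "g \<in> points" "h \<in> points" using A m by auto
  have nd: "tree_dist f g \<noteq> tree_dist f h + tree_dist h g"
    using label_neq_iff[OF P(3,1,2) ne] lab by simp
  have eq: "extends h f \<longleftrightarrow> extends h g"
    using label_stop_iff[OF P(3,1) ne(1)] label_stop_iff[OF P(3,2) ne(2)] lab by metis
  show ?thesis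
  proof (cases "extends h f")
    case True
    then have mm: "meet h f = height h" "meet h g = height h" "meet f h = height h" "meet g h = height h"
      using eq extends_iff_meet P by (auto simp: meet_commute[of _ h])
    define p where "p = cut f (meet f g)"
    have le: "meet f g \<le> height f" "meet f g \<le> height g" using meet_le P by auto
    have "height h \<le> meet f g" using meet_ultra[of f h g] P mm by simp
    moreover have "height h \<noteq> meet f g" using nd mm by (simp add: tree_dist_eq P)
    ultimately have lt: "height h < meet f g" by simp
    have p: "p \<in> points" "height p = meet f g" "p \<in> A"
      using cut_in_points height_cut P le A m(1) by (auto simp: p_def cut_closed_def)
    have "meet f p = meet f g" "meet h p = height h" "meet g p = meet f g"
      using lt le mm unfolding p_def by (simp_all add: meet_cut_right P meet_self meet_commute[of g f])
    then show ?thesis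
      using p lt mm
      by (intro that[of p]) (auto simp: tree_dist_eq P meet_commute[of p])
  next
    case False
    \<comment> \<open>Each path descends along \<open>h\<close> at least down to the larger of the
      two meets, so the truncation there lies on both.\<close>
    define a where "a = max (meet h f) (meet h g)"
    have le: "meet h f \<le> height h" "meet h g \<le> height h" using meet_le P by auto
    then have lt: "a < height h"
      using False eq extends_iff_meet P unfolding a_def by (metis max_less_iff_conj order.strict_iff_order)
    define p where "p = cut h a"
    have p: "p \<in> points" "height p = a" "p \<in> A"
      using cut_in_points height_cut P lt A m(3) by (auto simp: p_def cut_closed_def)
    have "meet f p = meet h f" "meet h p = a" "meet g p = meet h g"
      using lt unfolding p_def
      by (simp_all add: meet_cut_right P meet_self meet_commute[of f h] meet_commute[of g h] a_def)
    then show ?thesis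
      using p lt
      by (intro that[of p]) (auto simp: tree_dist_eq P meet_commute[of p] meet_commute[of f h])
  qed
qed

section \<open>Segments, arcs and connected sets in a truncation-closed set\<close>

context
  fixes A assumes A: "A \<subseteq> points" and cc: "cut_closed A"
begin

interpretation M: Metric_space A tree_dist by (rule Metric_space_tree[OF A])

lemma mtopology_of_tree: "mtopology_of (tree A) = M.mtopology"
  by (simp add: mtopology_of_def A)

lemma tree_geodesic:
  assumes x: "x \<in> A" and y: "y \<in> A"
  obtains g where "g \<in> {0..tree_dist x y} \<rightarrow> A" "g 0 = x" "g (tree_dist x y) = y"
    "\<And>s t. s \<in> {0..tree_dist x y} \<Longrightarrow> t \<in> {0..tree_dist x y} \<Longrightarrow> tree_dist (g s) (g t) = \<bar>s - t\<bar>"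
proof -
  have P: "x \<in> points" "y \<in> points" using A x y by auto
  let ?m = "meet x y" let ?L = "tree_dist x y"
  have le: "?m \<le> height x" "?m \<le> height y" using meet_le P by auto
  have L: "?L = height x + height y - 2 * ?m" by (rule tree_dist_eq[OF P])
  \<comment> \<open>Down along \<open>x\<close> to the meet, reached at time
    \<open>height x - ?m\<close>, then up along \<open>y\<close>.\<close>
  define g where "g s = (if s \<le> height x - ?m then cut x (height x - s) else cut y (2 * ?m - height x + s))" for s
  have "g \<in> {0..?L} \<rightarrow> A"
    using cc x y le by (auto simp: g_def cut_closed_def L)
  moreover have "g 0 = x" using le P by (simp add: g_def)
  moreover have "g ?L = y"
  proof (cases "?L \<le> height x - ?m")
    case True
    then have h: "height y = ?m" using le L by simp
    then have "extends y x" using extends_iff_meet[of y x] P by (simp add: meet_commute)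
    then have "y = cut x (height y)" using extends_iff_cut P by metis
    then show ?thesis using True h L by (simp add: g_def)
  next
    case False
    then show ?thesis using P by (simp add: g_def L)
  qed
  moreover have "tree_dist (g s) (g t) = \<bar>s - t\<bar>" if "s \<in> {0..?L}" "t \<in> {0..?L}" for s t
  proof -
    have *: "tree_dist (cut f a) (cut h b) = a + b - 2 * min (min a b) (meet f h)"
      if "f \<in> points" "h \<in> points" "a \<le> height f" "b \<le> height h" for f h a b
      using that by (simp add: tree_dist_eq cut_in_points height_cut meet_cut)
    show ?thesis
      using that le unfolding g_def L by (auto simp: * P meet_self meet_commute[of y x] min_def abs_if)
  qed
  ultimately show ?thesis using that by blast
qed

lemma geodesic_metric_tree: "geodesic_metric (tree A)"
  unfolding geodesic_metric_def proof (intro ballI)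
  fix x y assume "x \<in> mspace (tree A)" "y \<in> mspace (tree A)"
  then have "x \<in> A" "y \<in> A" by (simp_all add: A)
  then obtain g where "g \<in> {0..tree_dist x y} \<rightarrow> A" "g 0 = x" "g (tree_dist x y) = y"
    "\<And>s t. s \<in> {0..tree_dist x y} \<Longrightarrow> t \<in> {0..tree_dist x y} \<Longrightarrow> tree_dist (g s) (g t) = \<bar>s - t\<bar>"
    by (rule tree_geodesic) (rule that)
  then show "\<exists>g. g \<in> {0..mdist (tree A) x y} \<rightarrow> mspace (tree A) \<and> g 0 = x \<and> g (mdist (tree A) x y) = y \<and>
     (\<forall>s\<in>{0..mdist (tree A) x y}. \<forall>t\<in>{0..mdist (tree A) x y}. mdist (tree A) (g s) (g t) = \<bar>s - t\<bar>)"
    by (intro exI[of _ g]) (simp add: A)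
qed

lemma tree_arc:
  assumes x: "x \<in> A" and y: "y \<in> A"
  obtains g where "pathin M.mtopology g" "g 0 = x" "g 1 = y" "x \<noteq> y \<Longrightarrow> inj_on g {0..1}"
    "\<And>t. t \<in> {0..1} \<Longrightarrow> tree_dist x y = tree_dist x (g t) + tree_dist (g t) y"
proof -
  let ?L = "tree_dist x y"
  have L: "0 \<le> ?L" by (rule tree_dist_nonneg)
  obtain g where g: "g \<in> {0..?L} \<rightarrow> A" "g 0 = x" "g ?L = y"
    "\<And>s t. s \<in> {0..?L} \<Longrightarrow> t \<in> {0..?L} \<Longrightarrow> tree_dist (g s) (g t) = \<bar>s - t\<bar>"
    using tree_geodesic[OF x y] by blast
  define h where "h t = g (?L * t)" for t
  have in_L: "?L * t \<in> {0..?L}" if "t \<in> {0..1}" for t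
    using that L by (simp add: mult_left_le)
  have h: "tree_dist (h s) (h t) = ?L * \<bar>s - t\<bar>" if "s \<in> {0..1}" "t \<in> {0..1}" for s t
    using g(4)[OF in_L in_L, of s t] that L by (simp add: h_def abs_mult flip: right_diff_distrib)
  have hA: "h t \<in> A" if "t \<in> {0..1}" for t
    using g(1) in_L[OF that] by (auto simp: h_def)
  have "continuous_map (top_of_set {0..1}) M.mtopology h"
    unfolding M.continuous_map_to_metric
  proof (intro ballI allI impI)
    fix t e :: real assume t: "t \<in> topspace (top_of_set {0..1})" and e: "0 < e"
    \<comment> \<open>The summand 1 keeps the denominator positive when
      \<open>x = y\<close>.\<close>
    have "h u \<in> M.mball (h t) e" if u: "u \<in> {0..1} \<inter> ball t (e / (?L + 1))" for u
    proof -
      have "\<bar>t - u\<bar> * (?L + 1) < e"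
        using u L e by (simp add: dist_real_def pos_less_divide_eq)
      then have "?L * \<bar>t - u\<bar> < e" by (simp add: algebra_simps)
      then show ?thesis using h[of t u] t u hA by (simp add: M.in_mball)
    qed
    moreover have "openin (top_of_set {0..1}) ({0..1} \<inter> ball t (e / (?L + 1)))"
      by (simp add: openin_open_Int)
    moreover have "t \<in> {0..1} \<inter> ball t (e / (?L + 1))"
      using t e add_nonneg_pos[OF L zero_less_one] by simp
    ultimately show "\<exists>U. openin (top_of_set {0..1}) U \<and> t \<in> U \<and> (\<forall>u\<in>U. h u \<in> M.mball (h t) e)"
      by blast
  qed
  then have "pathin M.mtopology h" by (simp add: pathin_def)
  moreover have "h 0 = x" "h 1 = y" using g by (simp_all add: h_def)
  moreover have "inj_on h {0..1}" if "x \<noteq> y"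
  proof (rule inj_onI)
    fix s t :: real assume st: "s \<in> {0..1}" "t \<in> {0..1}" "h s = h t"
    have "?L * \<bar>s - t\<bar> = 0" using h[OF st(1,2)] st hA by simp
    moreover have "?L \<noteq> 0" using that x y by simp
    ultimately show "s = t" by simp
  qed
  moreover have "?L = tree_dist x (h t) + tree_dist (h t) y" if "t \<in> {0..1}" for t
    using h[of 0 t] h[of t 1] that \<open>h 0 = x\<close> \<open>h 1 = y\<close> by (simp add: algebra_simps)
  ultimately show ?thesis using that by blast
qed

text \<open>A change of label would put \<open>z\<close> between \<open>x\<close> and
  \<open>w\<close>, making \<open>w\<close> at least as far from \<open>x\<close> as
  \<open>z\<close> is. So labels are constant on the ball around \<open>x\<close> that just misses
  \<open>z\<close>.\<close>

lemma openin_label: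
  assumes z: "z \<in> A"
  shows "openin M.mtopology {w \<in> A - {z}. label z w \<in> C}"
  unfolding M.openin_mtopology
proof (intro conjI allI impI)
  fix x assume x: "x \<in> {w \<in> A - {z}. label z w \<in> C}"
  have "M.mball x (tree_dist x z) \<subseteq> {w \<in> A - {z}. label z w \<in> C}"
  proof
    fix w assume w: "w \<in> M.mball x (tree_dist x z)"
    then have w': "w \<in> A" "tree_dist x w < tree_dist x z" by simp_all
    then have "w \<noteq> z" by auto
    moreover have "label z x = label z w"
      using label_neq_iff[of z x w] w' \<open>w \<noteq> z\<close> x z A tree_dist_nonneg[of z w] by (auto simp: subset_iff)
    ultimately show "w \<in> {w \<in> A - {z}. label z w \<in> C}" using w' x by auto
  qed
  moreover have "tree_dist x z > 0" using x z A by (intro tree_dist_pos) auto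
  ultimately show "\<exists>r>0. M.mball x r \<subseteq> {w \<in> A - {z}. label z w \<in> C}" by blast
qed auto

lemma connectedin_label:
  assumes z: "z \<in> A" and S: "connectedin M.mtopology S" "z \<notin> S" "x \<in> S" "y \<in> S"
  shows "label z x = label z y"
proof -
  let ?X = "subtopology M.mtopology (A - {z})"
  let ?V = "{w \<in> A - {z}. label z w \<in> {label z x}}"
  have SA: "S \<subseteq> A - {z}" using S connectedin_subset_topspace[OF S(1)] by auto
  have conn: "connectedin ?X S" using S(1) SA by (simp add: connectedin_subtopology)
  have "openin ?X ({w \<in> A - {z}. label z w \<in> C} \<inter> (A - {z}))" for C
    using openin_label[OF z, of C] by (rule openin_subtopology_Int)
  moreover have "{w \<in> A - {z}. label z w \<in> C} \<inter> (A - {z}) = {w \<in> A - {z}. label z w \<in> C}" for C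
    by auto
  ultimately have op: "openin ?X {w \<in> A - {z}. label z w \<in> C}" for C by simp
  have "topspace ?X - ?V = {w \<in> A - {z}. label z w \<in> - {label z x}}" by auto
  then have "closedin ?X ?V"
    unfolding closedin_def using op[of "- {label z x}"] by auto
  then have "S \<subseteq> ?V \<or> disjnt S ?V"
    using connectedin_clopen_cases[OF conn] op[of "{label z x}"] by blast
  then have "y \<in> ?V" using S SA by (auto simp: disjnt_iff)
  then show ?thesis by simp
qed

lemma connectedin_between:
  assumes S: "connectedin M.mtopology S" "x \<in> S" "y \<in> S"
    and p: "p \<in> A" "tree_dist x y = tree_dist x p + tree_dist p y"
  shows "p \<in> S"
proof (rule ccontr)
  assume "p \<notin> S"
  have "S \<subseteq> A" using connectedin_subset_topspace[OF S(1)] by simp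
  then have "x \<in> points" "y \<in> points" "p \<in> points" using S p A by auto
  moreover have "x \<noteq> p" "y \<noteq> p" using S \<open>p \<notin> S\<close> by auto
  ultimately have "label p x \<noteq> label p y" using label_neq_iff[of p x y] p by simp
  then show False using connectedin_label[OF p(1) S(1) \<open>p \<notin> S\<close> S(2,3)] by simp
qed

text \<open>An arc covers the segment because removing a point between its ends separates them.
  Conversely, from a place off the segment both ends are seen in the same direction, so the arc
  meets the point \<open>p\<close> of \<open>median\<close> both before and after that place,
  against injectivity.\<close>

lemma arc_image:
  assumes g: "pathin M.mtopology g" "inj_on g {0..1}" "g 0 = x" "g 1 = y"
  shows "g ` {0..1} = {p \<in> A. tree_dist x y = tree_dist x p + tree_dist p y}"
proof
  have conn: "connectedin M.mtopology (g ` {a..b})" if "{a..b} \<subseteq> {0..1}" for a b :: real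
  proof (rule connectedin_continuous_map_image)
    show "continuous_map (top_of_set {0..1}) M.mtopology g" using g(1) by (simp add: pathin_def)
    show "connectedin (top_of_set {0..1}) {a..b}" using that by (auto simp: connectedin_subtopology)
  qed
  have gA: "g ` {0..1} \<subseteq> A"
    using connectedin_subset_topspace[OF conn[OF order_refl]] by simp
  have xy: "x \<in> A" "y \<in> A" using gA g by force+
  show "{p \<in> A. tree_dist x y = tree_dist x p + tree_dist p y} \<subseteq> g ` {0..1}"
  proof clarify
    fix p assume "p \<in> A" "tree_dist x y = tree_dist x p + tree_dist p y"
    then show "p \<in> g ` {0..1}"
      by (rule connectedin_between[rotated -2, OF _ _ conn[of 0 1]]) (use g in \<open>auto intro: rev_image_eqI\<close>)
  qed
  show "g ` {0..1} \<subseteq> {p \<in> A. tree_dist x y = tree_dist x p + tree_dist p y}"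
  proof
    fix w assume "w \<in> g ` {0..1}"
    then obtain t where t: "t \<in> {0..1}" "w = g t" by blast
    have w: "w \<in> A" using gA t by blast
    show "w \<in> {p \<in> A. tree_dist x y = tree_dist x p + tree_dist p y}"
    proof (rule ccontr)
      assume "\<not> ?thesis"
      then have n: "tree_dist x y \<noteq> tree_dist x w + tree_dist w y" using w by simp
      then have ne: "x \<noteq> w" "y \<noteq> w" using xy w by auto
      have "label w x = label w y" using label_neq_iff[of w x y] ne n xy w A by blast
      then obtain p where p: "p \<in> A" "p \<noteq> w" "tree_dist x w = tree_dist x p + tree_dist p w"
        "tree_dist w y = tree_dist w p + tree_dist p y"
        using median[OF A cc xy w ne] by blast
      have "p \<in> g ` {0..t}"
        by (rule connectedin_between[OF conn _ _ p(1,3)]) (use t g in auto)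
      moreover have "p \<in> g ` {t..1}"
        by (rule connectedin_between[OF conn _ _ p(1,4)]) (use t g in auto)
      ultimately obtain a b where ab: "a \<in> {0..t}" "b \<in> {t..1}" "p = g a" "p = g b" by blast
      then have "a = b" using inj_onD[OF g(2), of a b] t by auto
      then have "p = w" using ab t by (metis atLeastAtMost_iff order_antisym)
      with p(2) show False ..
    qed
  qed
qed

theorem real_tree_tree: "A \<noteq> {} \<Longrightarrow> real_tree (tree A)"
  unfolding real_tree_def
proof (intro conjI ballI impI)
  assume "A \<noteq> {}" then show "mspace (tree A) \<noteq> {}" by (simp add: A)
  show "geodesic_metric (tree A)" by (rule geodesic_metric_tree)
  fix x y assume xy: "x \<in> mspace (tree A)" "y \<in> mspace (tree A)" "x \<noteq> y"
  then have "x \<in> A" "y \<in> A" by (simp_all add: A)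
  then obtain g where "pathin M.mtopology g" "g 0 = x" "g 1 = y" "inj_on g {0..1}"
    by (rule tree_arc) (use xy(3) that in simp)
  then have ex: "arc_between (tree A) x y (g ` {0..1})"
    unfolding arc_between_def mtopology_of_tree by blast
  have un: "B = {p \<in> A. tree_dist x y = tree_dist x p + tree_dist p y}" if "arc_between (tree A) x y B" for B
  proof -
    obtain h where h: "pathin M.mtopology h" "inj_on h {0..1}" "h 0 = x" "h 1 = y" "h ` {0..1} = B"
      using \<open>arc_between (tree A) x y B\<close> unfolding arc_between_def mtopology_of_tree by blast
    show ?thesis using arc_image[OF h(1-4)] h(5) by simp
  qed
  show "\<exists>!B. arc_between (tree A) x y B"
  proof (rule ex1I)
    show "arc_between (tree A) x y (g ` {0..1})" by (rule ex)
    show "B = g ` {0..1}" if "arc_between (tree A) x y B" for B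
      by (rule trans[OF un[OF that] un[OF ex, symmetric]])
  qed
qed

text \<open>Points with equal labels at \<open>z\<close> are joined by an arc avoiding
  \<open>z\<close>, as \<open>z\<close> is not between them; points with different labels are
  separated since labels are locally constant.\<close>

lemma directions_tree:
  assumes z: "z \<in> A"
  shows "directions (tree A) z = (\<lambda>c. {w \<in> A - {z}. label z w = c}) ` label z ` (A - {z})"
proof -
  let ?X = "subtopology M.mtopology (A - {z})"
  have "connected_component_of ?X x y \<longleftrightarrow> y \<in> A - {z} \<and> label z y = label z x" if x: "x \<in> A - {z}" for x y
  proof
    assume "connected_component_of ?X x y"
    then obtain S where S: "connectedin ?X S" "x \<in> S" "y \<in> S" unfolding connected_component_of_def by blast
    then have "connectedin M.mtopology S" "S \<subseteq> A - {z}" by (simp_all add: connectedin_subtopology)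
    then show "y \<in> A - {z} \<and> label z y = label z x"
      using connectedin_label[OF z, of S y x] S by blast
  next
    assume y: "y \<in> A - {z} \<and> label z y = label z x"
    have "x \<in> A" "y \<in> A" using x y by auto
    then obtain g where g: "pathin M.mtopology g" "g 0 = x" "g 1 = y"
      "\<And>t. t \<in> {0..1} \<Longrightarrow> tree_dist x y = tree_dist x (g t) + tree_dist (g t) y"
      by (rule tree_arc) (rule that)
    have "tree_dist x y \<noteq> tree_dist x z + tree_dist z y"
      using label_neq_iff[of z x y] x y z A by (auto simp: subset_iff)
    then have "z \<notin> g ` {0..1}" using g(4) by blast
    moreover have "g ` {0..1} \<subseteq> A" using path_image_subset_topspace[OF g(1)] by auto
    ultimately have "connectedin ?X (g ` {0..1})"
      using connectedin_path_image[OF g(1)] by (auto simp: connectedin_subtopology)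
    moreover have "x \<in> g ` {0..1}" "y \<in> g ` {0..1}" using g by force+
    ultimately show "connected_component_of ?X x y" unfolding connected_component_of_def by blast
  qed
  then have "connected_component_of_set ?X x = {w \<in> A - {z}. label z w = label z x}" if "x \<in> A - {z}" for x
    using that by blast
  moreover have "topspace ?X = A - {z}" by auto
  ultimately show ?thesis
    unfolding directions_def connected_components_of_def mtopology_of_tree
    by (simp add: A image_image)
qed

lemma valence_tree:
  assumes z: "z \<in> A"
  shows "(valence (tree A) z, |label z ` (A - {z})| ) \<in> ordIso"
proof -
  have "inj_on (\<lambda>c. {w \<in> A - {z}. label z w = c}) (label z ` (A - {z}))"
    by (rule inj_onI) blast
  then have "bij_betw (\<lambda>c. {w \<in> A - {z}. label z w = c}) (label z ` (A - {z})) (directions (tree A) z)"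
    unfolding directions_tree[OF z] by (rule inj_on_imp_bij_betw)
  then have "|label z ` (A - {z})| =o |directions (tree A) z|" by (rule card_of_ordIsoI)
  then show ?thesis unfolding valence_def by (rule ordIso_symmetric)
qed

end


section \<open>Subtrees of bounded rank\<close>

text \<open>Only the left side is tested, as points are constant to the right of every place. The
  height of a point counts as a jump, because the value there is \<open>stop\<close>.\<close>

definition jumps :: "(real \<Rightarrow> 'k) \<Rightarrow> real set" where
  "jumps f = {t. \<nexists>s. s < t \<and> (\<forall>u\<in>{s<..<t}. f u = f t)}"

lemma not_jumpI: "s < t \<Longrightarrow> (\<And>u. s < u \<Longrightarrow> u < t \<Longrightarrow> f u = f t) \<Longrightarrow> t \<notin> jumps f"
  unfolding jumps_def by auto

lemma not_jumpE:
  assumes "t \<notin> jumps f"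
  obtains s where "s < t" "\<And>u. s < u \<Longrightarrow> u < t \<Longrightarrow> f u = f t"
proof -
  obtain s where "s < t" "\<forall>u\<in>{s<..<t}. f u = f t" using assms unfolding jumps_def by blast
  then show ?thesis by (intro that[of s]) auto
qed

lemma jumps_local:
  assumes "a < t" "\<And>u. a < u \<Longrightarrow> u \<le> t \<Longrightarrow> f u = g u" "t \<in> jumps f"
  shows "t \<in> jumps g"
proof (rule ccontr)
  assume "t \<notin> jumps g"
  then obtain s where s: "s < t" "\<And>u. s < u \<Longrightarrow> u < t \<Longrightarrow> g u = g t" by (rule not_jumpE) (rule that)
  have "t \<notin> jumps f"
  proof (rule not_jumpI)
    show "max a s < t" using assms(1) s(1) by simp
    show "f u = f t" if "max a s < u" "u < t" for u
      using assms(2)[of u] assms(2)[of t] s(2)[of u] that assms(1) by simp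
  qed
  with assms(3) show False by simp
qed

lemma jumps_gap:
  assumes "f \<in> points" shows "\<exists>s>t. jumps f \<inter> {t<..<s} = {}"
proof -
  obtain s where s: "s > t" "\<And>u. t \<le> u \<Longrightarrow> u < s \<Longrightarrow> f u = f t"
    using points_right_const[OF assms] by blast
  have "u \<notin> jumps f" if "u \<in> {t<..<s}" for u
  proof (rule not_jumpI)
    show "t < u" using that by simp
    show "f v = f u" if "t < v" "v < u" for v
      using s(2)[of v] s(2)[of u] that \<open>u \<in> {t<..<s}\<close> by simp
  qed
  then show ?thesis using s(1) by blast
qed

lemma bdd_below_jumps:
  assumes "f \<in> points" shows "bdd_below (jumps f)"
proof -
  obtain l where l: "\<And>t. t < l \<Longrightarrow> f t = base" using points_base[OF assms] by blast
  have "t \<notin> jumps f" if "t < l" for t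
  proof (rule not_jumpI)
    show "t - 1 < t" by simp
    show "f u = f t" if "u < t" for u using l[of t] l[of u] that \<open>t < l\<close> by simp
  qed
  then show ?thesis by (meson bdd_belowI not_less)
qed

lemma jumps_le_height:
  assumes "f \<in> points" "height f < t" shows "t \<notin> jumps f"
proof (rule not_jumpI[OF assms(2)])
  show "f u = f t" if "height f < u" for u
    using stop_iff[OF assms(1), of u] stop_iff[OF assms(1), of t] that assms(2) by simp
qed

text \<open>For \<alpha> = 1 these are the points with finitely many jumps. For \<alpha> = 0 the set
  is empty, which is why the indexing starts at 1.\<close>

definition subtree :: "omega1 \<Rightarrow> (real \<Rightarrow> 'k) set" where
  "subtree \<alpha> = {f \<in> points. rank_below \<alpha> (jumps f)}"

lemma subtree_subset: "subtree \<alpha> \<subseteq> points"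
  by (auto simp: subtree_def)

lemma subtree_points: "f \<in> subtree \<alpha> \<Longrightarrow> f \<in> points"
  by (auto simp: subtree_def)

lemma subtree_mono: "\<alpha> \<le> \<beta> \<Longrightarrow> subtree \<alpha> \<subseteq> subtree \<beta>"
  by (auto simp: subtree_def intro: rank_below_mono)

text \<open>Right constancy gives the jumps a uniform countable rank; hence the subtrees exhaust the
  universal tree.\<close>

lemma points_in_subtree:
  assumes "f \<in> points" obtains \<alpha> where "0 < \<alpha>" "f \<in> subtree \<alpha>"
proof -
  obtain \<beta> where \<beta>: "\<And>t. rank_le (jumps f) \<beta> t"
    using right_gaps_imp_rank_le[OF jumps_gap[OF assms] bdd_below_jumps[OF assms]] by blast
  obtain \<alpha> where "\<beta> < \<alpha>"
    by (rule countable_imp_bounded_omega1[of "{\<beta>}"]) auto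
  then have "rank_below \<alpha> (jumps f)"
    unfolding rank_below_def using \<beta> by blast
  moreover have "0 < \<alpha>" using \<open>\<beta> < \<alpha>\<close> zero_le_omega1 le_less_trans by blast
  ultimately show ?thesis using that assms by (simp add: subtree_def)
qed

lemma jumps_cut: "jumps (cut f t) \<subseteq> insert t (jumps f)"
proof
  fix u assume u: "u \<in> jumps (cut f t)"
  consider "u < t" | "u = t" | "t < u" by linarith
  then show "u \<in> insert t (jumps f)"
  proof cases
    case 1
    have "u \<in> jumps f" by (rule jumps_local[of "u - 1" u "cut f t"]) (use 1 u in \<open>auto simp: cut_def\<close>)
    then show ?thesis by simp
  next
    case 3
    then have "u \<notin> jumps (cut f t)" by (rule not_jumpI) (use 3 in \<open>auto simp: cut_def\<close>)
    with u show ?thesis by simp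
  qed simp
qed

lemma cut_in_subtree:
  assumes "0 < \<alpha>" "f \<in> subtree \<alpha>" "t \<le> height f" shows "cut f t \<in> subtree \<alpha>"
proof -
  have "rank_below \<alpha> (insert t (jumps f))"
    using assms by (simp add: subtree_def rank_below_insert)
  then show ?thesis
    using assms cut_in_points rank_below_subset[OF _ jumps_cut] by (simp add: subtree_def)
qed

lemma cut_closed_subtree: "0 < \<alpha> \<Longrightarrow> cut_closed (subtree \<alpha>)"
  unfolding cut_closed_def by (simp add: cut_in_subtree)

section \<open>Explicit points and the valence\<close>

definition origin :: "real \<Rightarrow> real \<Rightarrow> 'k" where
  "origin r = (\<lambda>t. if t < r then base else stop)"

lemma origin_in_points: "origin r \<in> points"
proof (rule pointsI[of _ r r])
  show "\<exists>s>t. \<forall>u. t \<le> u \<and> u < s \<longrightarrow> origin r u = origin r t" if "t < r" for t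
    using that by (intro exI[of _ r]) (simp add: origin_def)
qed (use K distinct in \<open>auto simp: origin_def\<close>)

lemma jumps_origin: "jumps (origin r) \<subseteq> {r}"
proof
  fix t assume t: "t \<in> jumps (origin r)"
  show "t \<in> {r}"
  proof (rule ccontr)
    assume "t \<notin> {r}"
    then have "t \<notin> jumps (origin r)"
      by (intro not_jumpI[of "if t < r then t - 1 else r"]) (auto simp: origin_def)
    with t show False by simp
  qed
qed

lemma origin_in_subtree: "0 < \<alpha> \<Longrightarrow> origin r \<in> subtree \<alpha>"
  unfolding subtree_def
  using origin_in_points rank_below_subset[OF rank_below_singleton jumps_origin] by simp

definition append_const :: "(real \<Rightarrow> 'k) \<Rightarrow> 'k \<Rightarrow> real \<Rightarrow> real \<Rightarrow> 'k" where
  "append_const f c d = (\<lambda>t. if t < height f then f t else if t < height f + d then c else stop)"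

context
  fixes f c d assumes f: "f \<in> points" and c: "c \<in> K" "c \<noteq> stop" and d: "0 < (d::real)"
begin

lemma append_const_in_points: "append_const f c d \<in> points"
proof -
  obtain l where l: "\<And>t. t < l \<Longrightarrow> f t = base" using points_base[OF f] by blast
  show ?thesis
  proof (rule pointsI[of _ "height f + d" "min l (height f)"])
    show "append_const f c d t \<in> K" for t
      using K c points_in_K[OF f] by (simp add: append_const_def)
    show "append_const f c d t = stop \<longleftrightarrow> height f + d \<le> t" for t
      using c d stop_iff[OF f, of t] by (simp add: append_const_def)
    show "append_const f c d t = base" if "t < min l (height f)" for t
      using that l by (simp add: append_const_def)
    show "\<exists>s>t. \<forall>u. t \<le> u \<and> u < s \<longrightarrow> append_const f c d u = append_const f c d t"
      if "t < height f + d" for t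
    proof (cases "t < height f")
      case True
      obtain s where s: "s > t" "\<And>u. t \<le> u \<Longrightarrow> u < s \<Longrightarrow> f u = f t"
        using points_right_const[OF f] by blast
      have "append_const f c d u = append_const f c d t" if "t \<le> u" "u < min s (height f)" for u
        using that s(2)[of u] True by (simp add: append_const_def)
      moreover have "min s (height f) > t" using s(1) True by simp
      ultimately show ?thesis by blast
    next
      case False
      then show ?thesis using that by (intro exI[of _ "height f + d"]) (simp add: append_const_def)
    qed
  qed
qed

lemma height_append_const: "height (append_const f c d) = height f + d"
  by (rule height_eqI) (use c d stop_iff[OF f] in \<open>auto simp: append_const_def\<close>)

lemma extends_append_const: "extends f (append_const f c d)"
  by (simp add: extends_def append_const_def)

lemma label_append_const: "label f (append_const f c d) = c"
  using d extends_append_const by (simp add: label_def append_const_def)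

lemma jumps_append_const: "jumps (append_const f c d) \<subseteq> insert (height f) (insert (height f + d) (jumps f))"
proof
  fix t assume t: "t \<in> jumps (append_const f c d)"
  consider "t < height f" | "t = height f \<or> t = height f + d" | "height f < t" "t < height f + d" | "height f + d < t" by linarith
  then show "t \<in> insert (height f) (insert (height f + d) (jumps f))"
  proof cases
    case 1
    have "t \<in> jumps f"
      by (rule jumps_local[of "t - 1" t "append_const f c d"]) (use 1 t in \<open>auto simp: append_const_def\<close>)
    then show ?thesis by simp
  next
    case 3
    then have "t \<notin> jumps (append_const f c d)"
      by (intro not_jumpI[of "height f"]) (auto simp: append_const_def)
    with t show ?thesis by simp
  next
    case 4
    then have "t \<notin> jumps (append_const f c d)"
      using d by (intro not_jumpI[of "height f + d"]) (auto simp: append_const_def)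
    with t show ?thesis by simp
  qed auto
qed

lemma append_const_in_subtree:
  assumes "0 < \<alpha>" "f \<in> subtree \<alpha>" shows "append_const f c d \<in> subtree \<alpha>"
proof -
  have "rank_below \<alpha> (insert (height f) (insert (height f + d) (jumps f)))"
    using assms by (simp add: subtree_def rank_below_insert)
  then show ?thesis
    using append_const_in_points rank_below_subset[OF _ jumps_append_const] by (simp add: subtree_def)
qed

end

text \<open>The downward direction is reached by truncating, each upward one by appending a constant
  piece. Either change adds finitely many jumps and stays in the subtree, so the valence does not
  depend on \<alpha>.\<close>

lemma label_image_subtree:
  assumes "0 < \<alpha>" "f \<in> subtree \<alpha>"
  shows "label f ` (subtree \<alpha> - {f}) = K"
proof
  have f: "f \<in> points" using assms by (simp add: subtree_def)
  show "label f ` (subtree \<alpha> - {f}) \<subseteq> K"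
    using points_in_K subtree_points K by (auto simp: label_def)
  show "K \<subseteq> label f ` (subtree \<alpha> - {f})"
  proof
    fix c assume c: "c \<in> K"
    show "c \<in> label f ` (subtree \<alpha> - {f})"
    proof (cases "c = stop")
      case True
      let ?g = "cut f (height f - 1)"
      have h: "height ?g = height f - 1" by (rule height_cut[OF f]) simp
      have "?g \<in> subtree \<alpha>" using assms by (intro cut_in_subtree) auto
      moreover have "\<not> extends f ?g"
        using extends_height_le[OF f cut_in_points[OF f], of "height f - 1"] h by auto
      moreover have "?g \<noteq> f" using h by auto
      ultimately show ?thesis using True by (auto simp: label_def intro!: rev_image_eqI[of ?g])
    next
      case False
      have "append_const f c 1 \<in> subtree \<alpha>"
        using assms f c False by (intro append_const_in_subtree) auto
      moreover have "label f (append_const f c 1) = c"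
        using f c False by (intro label_append_const) auto
      moreover have "append_const f c 1 \<noteq> f"
        using height_append_const[OF f c False, of 1] by auto
      ultimately show ?thesis by (auto intro!: rev_image_eqI[of "append_const f c 1"])
    qed
  qed
qed

lemma valence_subtree:
  assumes "0 < \<alpha>" "f \<in> subtree \<alpha>"
  shows "(valence (tree (subtree \<alpha>)) f, |K| ) \<in> ordIso"
  using valence_tree[OF subtree_subset cut_closed_subtree[OF assms(1)] assms(2)]
  by (simp add: label_image_subtree[OF assms])

lemma label_image_points:
  assumes f: "f \<in> points" shows "label f ` (points - {f}) = K"
proof
  show "label f ` (points - {f}) \<subseteq> K"
    using points_in_K K by (auto simp: label_def)
  obtain \<alpha> where "0 < \<alpha>" "f \<in> subtree \<alpha>" using points_in_subtree[OF f] by blast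
  then have "K = label f ` (subtree \<alpha> - {f})" by (simp add: label_image_subtree)
  also have "\<dots> \<subseteq> label f ` (points - {f})" using subtree_subset by blast
  finally show "K \<subseteq> label f ` (points - {f})" .
qed

lemma cut_closed_points: "cut_closed points"
  unfolding cut_closed_def by (simp add: cut_in_points)

lemma valence_points: "f \<in> points \<Longrightarrow> (valence (tree points) f, |K| ) \<in> ordIso"
  using valence_tree[OF order_refl cut_closed_points, of f] by (simp add: label_image_points)

section \<open>Homogeneity\<close>

definition translate :: "real \<Rightarrow> (real \<Rightarrow> 'k) \<Rightarrow> real \<Rightarrow> 'k" where
  "translate c f = (\<lambda>t. f (t - c))"

lemma translate_in_points:
  assumes "f \<in> points" shows "translate c f \<in> points"
proof -
  obtain l where l: "\<And>t. t < l \<Longrightarrow> f t = base" using points_base[OF assms] by blast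
  show ?thesis
  proof (rule pointsI[of _ "height f + c" "l + c"])
    show "translate c f t \<in> K" for t using points_in_K[OF assms] by (simp add: translate_def)
    show "translate c f t = stop \<longleftrightarrow> height f + c \<le> t" for t
      using stop_iff[OF assms, of "t - c"] by (auto simp: translate_def)
    show "translate c f t = base" if "t < l + c" for t using l that by (simp add: translate_def)
    show "\<exists>s>t. \<forall>u. t \<le> u \<and> u < s \<longrightarrow> translate c f u = translate c f t" for t
    proof -
      obtain s where s: "s > t - c" "\<And>u. t - c \<le> u \<Longrightarrow> u < s \<Longrightarrow> f u = f (t - c)"
        using points_right_const[OF assms] by blast
      have "translate c f u = translate c f t" if "t \<le> u" "u < s + c" for u
        using s(2)[of "u - c"] that by (simp add: translate_def)
      moreover have "s + c > t" using s(1) by simp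
      ultimately show ?thesis by blast
    qed
  qed
qed

lemma height_translate: "f \<in> points \<Longrightarrow> height (translate c f) = height f + c"
  by (rule height_eqI) (auto simp: translate_def stop_iff)

lemma translate_inverse: "translate (- c) (translate c f) = f" "translate c (translate (- c) f) = f"
  by (simp_all add: translate_def)

lemma meet_translate:
  assumes "f \<in> points" "g \<in> points"
  shows "meet (translate c f) (translate c g) = meet f g + c"
proof -
  have *: "t + c \<le> meet (translate c f) (translate c g) \<longleftrightarrow> t \<le> meet f g" for t
  proof -
    have "(\<forall>s<t + c. f (s - c) = g (s - c)) \<longleftrightarrow> (\<forall>s<t. f s = g s)"
      by (metis add_diff_cancel diff_less_eq less_diff_eq)
    then show ?thesis
      by (simp add: le_meet_iff translate_in_points height_translate assms) (simp add: translate_def)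
  qed
  from *[of "meet (translate c f) (translate c g) - c"] *[of "meet f g"] show ?thesis by simp
qed

lemma tree_dist_translate:
  "f \<in> points \<Longrightarrow> g \<in> points \<Longrightarrow> tree_dist (translate c f) (translate c g) = tree_dist f g"
  by (simp add: tree_dist_eq translate_in_points height_translate meet_translate)

lemma jumps_translate: "jumps (translate c f) \<subseteq> (\<lambda>x. x + c) ` jumps f"
proof
  fix t assume t: "t \<in> jumps (translate c f)"
  have "t - c \<in> jumps f"
  proof (rule ccontr)
    assume "t - c \<notin> jumps f"
    then obtain s where s: "s < t - c" "\<And>u. s < u \<Longrightarrow> u < t - c \<Longrightarrow> f u = f (t - c)"
      by (rule not_jumpE) (rule that)
    have "t \<notin> jumps (translate c f)"
    proof (rule not_jumpI)
      show "s + c < t" using s(1) by simp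
      show "translate c f u = translate c f t" if "s + c < u" "u < t" for u
        using s(2)[of "u - c"] that by (simp add: translate_def)
    qed
    with t show False by simp
  qed
  then show "t \<in> (\<lambda>x. x + c) ` jumps f" by (rule rev_image_eqI) simp
qed

lemma translate_in_subtree: "f \<in> subtree \<alpha> \<Longrightarrow> translate c f \<in> subtree \<alpha>"
  using rank_below_subset[OF rank_below_translate jumps_translate] translate_in_points
  by (simp add: subtree_def)

text \<open>
  A permutation of the colours at each place preserves the first difference of two points. The
  permutations chosen here carry \<open>a\<close> to the point of the same height all of whose colours are \<open>base\<close>.
\<close>

definition twist :: "(real \<Rightarrow> 'k) \<Rightarrow> (real \<Rightarrow> 'k) \<Rightarrow> real \<Rightarrow> 'k" where
  "twist a f = (\<lambda>t. if f t = stop then stop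
     else Transposition.transpose (if a t = stop then base else a t) base (f t))"

text \<open>Both entries of the transposition differ from \<open>stop\<close>, so no colour is
  turned into \<open>stop\<close>. Above the height of \<open>a\<close> the transposition is
  trivial.\<close>

lemma twist_stop_iff: "twist a f t = stop \<longleftrightarrow> f t = stop"
  using distinct by (auto simp: twist_def Transposition.transpose_def)

lemma twist_twist: "twist a (twist a f) = f"
proof
  show "twist a (twist a f) t = f t" for t
    using twist_stop_iff[of a f t] by (auto simp: twist_def)
qed

lemma twist_self:
  assumes "a \<in> points" shows "twist a a = origin (height a)"
  using stop_iff[OF assms] by (auto simp: twist_def origin_def fun_eq_iff not_le[symmetric])

lemma twist_in_points:
  assumes a: "a \<in> points" and f: "f \<in> points" shows "twist a f \<in> points"
proof -
  obtain l where l: "\<And>t. t < l \<Longrightarrow> f t = base" using points_base[OF f] by blast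
  obtain m where m: "\<And>t. t < m \<Longrightarrow> a t = base" using points_base[OF a] by blast
  show ?thesis
  proof (rule pointsI[of _ "height f" "min l m"])
    show "twist a f t \<in> K" for t
      using points_in_K[OF f, of t] points_in_K[OF a, of t] K
      by (simp add: twist_def Transposition.transpose_def)
    show "twist a f t = stop \<longleftrightarrow> height f \<le> t" for t
      using twist_stop_iff stop_iff[OF f] by simp
    \<comment> \<open>Near minus infinity \<open>a\<close> is \<open>base\<close> too, and the
      transposition is trivial.\<close>
    show "twist a f t = base" if "t < min l m" for t
      using l[of t] m[of t] that distinct by (simp add: twist_def)
    show "\<exists>s>t. \<forall>u. t \<le> u \<and> u < s \<longrightarrow> twist a f u = twist a f t" for t
    proof -
      obtain r where r: "r > t" "\<And>u. t \<le> u \<Longrightarrow> u < r \<Longrightarrow> f u = f t"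
        using points_right_const[OF f] by blast
      obtain s where s: "s > t" "\<And>u. t \<le> u \<Longrightarrow> u < s \<Longrightarrow> a u = a t"
        using points_right_const[OF a] by blast
      have "twist a f u = twist a f t" if "t \<le> u" "u < min r s" for u
        using r(2)[of u] s(2)[of u] that by (simp add: twist_def)
      moreover have "min r s > t" using r(1) s(1) by simp
      ultimately show ?thesis by blast
    qed
  qed
qed

lemma height_twist: "f \<in> points \<Longrightarrow> height (twist a f) = height f"
  by (rule height_eqI) (simp add: twist_stop_iff stop_iff)

lemma twist_eq_iff: "twist a f t = twist a g t \<longleftrightarrow> f t = g t"
  by (metis (no_types, opaque_lifting) twist_def twist_twist)

lemma meet_twist: "f \<in> points \<Longrightarrow> g \<in> points \<Longrightarrow> meet (twist a f) (twist a g) = meet f g"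
  by (simp add: meet_def height_twist twist_eq_iff)

lemma tree_dist_twist:
  "a \<in> points \<Longrightarrow> f \<in> points \<Longrightarrow> g \<in> points \<Longrightarrow> tree_dist (twist a f) (twist a g) = tree_dist f g"
  by (simp add: tree_dist_eq twist_in_points height_twist meet_twist)

lemma jumps_twist: "jumps (twist a f) \<subseteq> jumps f \<union> jumps a"
proof
  fix t assume t: "t \<in> jumps (twist a f)"
  show "t \<in> jumps f \<union> jumps a"
  proof (rule ccontr)
    assume "t \<notin> jumps f \<union> jumps a"
    then have n: "t \<notin> jumps f" "t \<notin> jumps a" by auto
    obtain r where r: "r < t" "\<And>u. r < u \<Longrightarrow> u < t \<Longrightarrow> f u = f t" using n(1) by (rule not_jumpE) (rule that)
    obtain s where s: "s < t" "\<And>u. s < u \<Longrightarrow> u < t \<Longrightarrow> a u = a t" using n(2) by (rule not_jumpE) (rule that)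
    have "t \<notin> jumps (twist a f)"
    proof (rule not_jumpI)
      show "max r s < t" using r s by simp
      show "twist a f u = twist a f t" if "max r s < u" "u < t" for u
        using r(2)[of u] s(2)[of u] that by (simp add: twist_def)
    qed
    with t show False by simp
  qed
qed

lemma twist_in_subtree:
  assumes "a \<in> subtree \<alpha>" "f \<in> subtree \<alpha>" shows "twist a f \<in> subtree \<alpha>"
proof -
  have "rank_below \<alpha> (jumps f \<union> jumps a)" using assms by (simp add: subtree_def rank_below_Un)
  then show ?thesis
    using assms twist_in_points rank_below_subset[OF _ jumps_twist] by (simp add: subtree_def)
qed

theorem homogeneous_subtree: "homogeneous (tree (subtree \<alpha>))"
  unfolding homogeneous_def mspace_tree[OF subtree_subset]
proof (intro ballI)
  fix x y assume xy: "x \<in> subtree \<alpha>" "y \<in> subtree \<alpha>"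
  then have P: "x \<in> points" "y \<in> points" using subtree_subset by auto
  let ?c = "height y - height x"
  \<comment> \<open>Send \<open>x\<close> to the constant point of its height, move that to the
    height of \<open>y\<close>, then undo the recolouring that belongs to \<open>y\<close>.\<close>
  define F where "F f = twist y (translate ?c (twist x f))" for f
  define G where "G f = twist x (translate (- ?c) (twist y f))" for f
  have maps: "F f \<in> subtree \<alpha>" "G f \<in> subtree \<alpha>" if "f \<in> subtree \<alpha>" for f
    using that xy by (simp_all add: F_def G_def twist_in_subtree translate_in_subtree)
  have FG: "F (G f) = f" for f
    by (simp only: F_def G_def twist_twist translate_inverse)
  have "tree_dist (F f) (F g) = tree_dist f g" if "f \<in> subtree \<alpha>" "g \<in> subtree \<alpha>" for f g
    using that P subtree_subset
    by (simp add: F_def tree_dist_twist tree_dist_translate twist_in_points translate_in_points subset_iff)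
  moreover have "F ` subtree \<alpha> = subtree \<alpha>"
  proof
    show "subtree \<alpha> \<subseteq> F ` subtree \<alpha>"
    proof
      fix f assume "f \<in> subtree \<alpha>"
      then show "f \<in> F ` subtree \<alpha>" using maps(2) FG by (intro rev_image_eqI[of "G f"]) simp_all
    qed
  qed (use maps in blast)
  moreover have "F x = y"
  proof -
    have "translate ?c (origin (height x)) = origin (height y)"
      by (auto simp: translate_def origin_def)
    then have "F x = twist y (twist y y)" by (simp add: F_def twist_self P)
    then show ?thesis by (simp add: twist_twist)
  qed
  ultimately show "\<exists>f. isometry (tree (subtree \<alpha>)) (tree (subtree \<alpha>)) f \<and> f x = y"
    unfolding isometry_def isometric_embedding_def mspace_tree[OF subtree_subset] mdist_tree[OF subtree_subset]
    using maps(1) by (intro exI[of _ F]) auto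
qed


section \<open>Climbing paths\<close>

lemma extends_chain:
  assumes "\<And>n. Y n \<in> points" "\<And>n. extends (Y n) (Y (Suc n))" "m \<le> n"
  shows "extends (Y m) (Y n)"
  using assms(3)
proof (induction n rule: dec_induct)
  case (step n)
  then show ?case using extends_trans assms(1,2) by blast
qed simp

lemma chain_limit:
  assumes Y: "\<And>n. Y n \<in> points" "\<And>n. extends (Y n) (Y (Suc n))" "\<And>n. height (Y n) < r"
    and ex: "\<And>t. t < r \<Longrightarrow> \<exists>n. t < height (Y n)"
  obtains g where "g \<in> points" "height g = r" "\<And>n. extends (Y n) g"
proof -
  have agree: "Y m u = Y n u" if "u < height (Y m)" "u < height (Y n)" for m n u
  proof -
    have "extends (Y m) (Y (max m n))" "extends (Y n) (Y (max m n))"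
      using extends_chain[of Y] Y by simp_all
    then show ?thesis using that unfolding extends_def by metis
  qed
  obtain N where N: "\<And>t. t < r \<Longrightarrow> t < height (Y (N t))" using ex by metis
  obtain g where g: "g \<in> points" "height g = r" "\<And>t u. t < r \<Longrightarrow> u \<le> t \<Longrightarrow> g u = Y (N t) u"
  proof (rule glue[of r "\<lambda>t. Y (N t)"])
    show "Y (N s) u = Y (N t) u" if "s \<le> t" "t < r" "u \<le> s" for s t u
      using N[of s] N[of t] that by (intro agree) simp_all
  qed (use Y N in auto)
  have "extends (Y n) g" for n
    unfolding extends_def
  proof (intro allI impI)
    fix u assume u: "u < height (Y n)"
    then have "u < r" using Y(3)[of n] by simp
    then show "Y n u = g u" using g(3)[of u u] agree[OF u N[of u]] by simp
  qed
  then show ?thesis using that g by blast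
qed

lemma extends_cut_eq: "extends f g \<Longrightarrow> t \<le> height f \<Longrightarrow> cut g t = cut f t"
  by (auto simp: extends_def cut_def fun_eq_iff)

lemma extends_to_cut: "extends f g \<Longrightarrow> height f \<le> t \<Longrightarrow> extends f (cut g t)"
  by (simp add: extends_def cut_def)

lemma rank_le_jumps_local:
  assumes "rank_le (jumps f) \<alpha> t" "\<And>s. s < t \<Longrightarrow> f s = g s"
  shows "rank_le (jumps g) \<alpha> t"
proof (rule rank_le_subset[OF assms(1)])
  show "jumps g \<inter> {..<t} \<subseteq> jumps f"
  proof
    fix u assume "u \<in> jumps g \<inter> {..<t}"
    then show "u \<in> jumps f" by (intro jumps_local[of "u - 1" u g f]) (auto simp: assms(2))
  qed
qed

lemma tree_dist_extends:
  assumes "f \<in> points" "g \<in> points" "extends f g" shows "tree_dist f g = height g - height f"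
  using assms extends_iff_meet[of f g] by (simp add: tree_dist_eq)

lemma extends_antisym: "f \<in> points \<Longrightarrow> g \<in> points \<Longrightarrow> extends f g \<Longrightarrow> height g \<le> height f \<Longrightarrow> f = g"
  using extends_height_le[of f g] extends_iff_cut[of f g] by (metis cut_height order_antisym)

end

text \<open>Two cases are covered: the identity, for incompleteness, and a normalised isometry onto
  another subtree. Control of \<phi> is assumed only above \<open>x0\<close>, since an isometry may
  bend other parts downwards.\<close>

locale climbing =
  coded_tree K stop base other for K :: "'k set" and stop base other +
  fixes \<beta> :: omega1 and \<phi> :: "(real \<Rightarrow> 'k) \<Rightarrow> (real \<Rightarrow> 'k)" and x0 :: "real \<Rightarrow> 'k"
  assumes \<beta>: "0 < \<beta>" and x0: "x0 \<in> subtree \<beta>"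
    and \<phi>_points: "\<And>z. z \<in> subtree \<beta> \<Longrightarrow> extends x0 z \<Longrightarrow> \<phi> z \<in> points"
    and height_\<phi>: "\<And>z. z \<in> subtree \<beta> \<Longrightarrow> extends x0 z \<Longrightarrow> height (\<phi> z) = height z"
    and \<phi>_extends: "\<And>z w. z \<in> subtree \<beta> \<Longrightarrow> w \<in> subtree \<beta> \<Longrightarrow> extends x0 z \<Longrightarrow> extends z w \<Longrightarrow>
      extends (\<phi> z) (\<phi> w)"
begin

definition cone :: "(real \<Rightarrow> 'k) set" where
  "cone = {z \<in> subtree \<beta>. extends x0 z}"

lemma coneD: "z \<in> cone \<Longrightarrow> z \<in> subtree \<beta>" "z \<in> cone \<Longrightarrow> z \<in> points" "z \<in> cone \<Longrightarrow> extends x0 z"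
  "z \<in> cone \<Longrightarrow> \<phi> z \<in> points" "z \<in> cone \<Longrightarrow> height (\<phi> z) = height z" "z \<in> cone \<Longrightarrow> height x0 \<le> height z"
  unfolding cone_def using \<phi>_points height_\<phi> extends_height_le x0 subtree_points by auto

lemma cone_extends:
  assumes "x \<in> cone" "z \<in> subtree \<beta>" "extends x z" shows "z \<in> cone"
  unfolding cone_def using assms coneD[OF assms(1)] x0 extends_trans[of x0 x z] subtree_points by auto

text \<open>The image of a truncation lies below \<open>\<phi> z\<close> at the prescribed height,
  and there is only one such point.\<close>

lemma \<phi>_cut:
  assumes z: "z \<in> cone" and t: "height x0 \<le> t" "t \<le> height z"
  shows "cut z t \<in> cone" "\<phi> (cut z t) = cut (\<phi> z) t"
proof -
  note zD = coneD[OF z]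
  show c: "cut z t \<in> cone"
    using zD t cut_in_subtree[OF \<beta>] extends_to_cut by (simp add: cone_def)
  note cD = coneD[OF c]
  have h: "height (\<phi> (cut z t)) = t" using cD zD t height_cut by simp
  have "extends (\<phi> (cut z t)) (\<phi> z)"
    by (rule \<phi>_extends[OF cD(1) zD(1) cD(3)]) (rule extends_cut[OF zD(2) t(2)])
  then show "\<phi> (cut z t) = cut (\<phi> z) t"
    using extends_iff_cut[OF cD(4) zD(4)] h by simp
qed

text \<open>
  \<open>g\<close> codes a path upwards from \<open>x\<close>, without its end point, and \<open>h\<close> codes the image of this path
  under \<open>\<phi>\<close>. The jump at the start of the path makes the jumps accumulate when infinitely many
  climbs are concatenated.
\<close>

definition climb :: "omega1 \<Rightarrow> (real \<Rightarrow> 'k) \<Rightarrow> real \<Rightarrow> (real \<Rightarrow> 'k) \<Rightarrow> (real \<Rightarrow> 'k) \<Rightarrow> bool" where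
  "climb \<gamma> x e g h \<longleftrightarrow> g \<in> points \<and> h \<in> points \<and> extends x g \<and> height x < height g \<and>
     height g < height x + e \<and> height h = height g \<and>
     (\<forall>t. height x \<le> t \<and> t < height g \<longrightarrow> cut g t \<in> subtree \<beta> \<and> \<phi> (cut g t) = cut h t) \<and>
     height x \<in> jumps g \<and> (\<forall>\<delta><\<gamma>. \<not> rank_le (jumps g) \<delta> (height g)) \<and>
     (\<forall>t. height x < t \<and> t \<le> height g \<longrightarrow> rank_le (jumps g) \<gamma> t \<and> rank_le (jumps h) \<gamma> t)"

text \<open>As long as the rank stays below \<beta>, the end of the path is still in the subtree,
  and its image has the same truncations as \<open>h\<close>. This is what allows a further climb to
  start there.\<close>

lemma climb_end:
  assumes c: "climb \<gamma> x e g h" and x: "x \<in> cone" and \<gamma>: "\<gamma> < \<beta>"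
  shows "g \<in> cone" "\<phi> g = h"
proof -
  have P: "g \<in> points" "h \<in> points" and xg: "extends x g" and hh: "height h = height g"
    and ht: "height x < height g"
    and cut: "\<And>t. height x \<le> t \<Longrightarrow> t < height g \<Longrightarrow> \<phi> (cut g t) = cut h t"
    and rk: "\<And>t. height x < t \<Longrightarrow> t \<le> height g \<Longrightarrow> rank_le (jumps g) \<gamma> t"
    using c unfolding climb_def by blast+
  note xD = coneD[OF x]
  have "\<exists>\<delta><\<beta>. rank_le (jumps g) \<delta> t" for t
  proof -
    consider "t \<le> height x" | "height x < t" "t \<le> height g" | "height g < t" by linarith
    then show ?thesis
    proof cases
      case 1
      obtain \<delta> where "\<delta> < \<beta>" "rank_le (jumps x) \<delta> t"
        using xD(1) unfolding subtree_def rank_below_def by blast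
      moreover have "rank_le (jumps g) \<delta> t"
        by (rule rank_le_jumps_local[OF \<open>rank_le (jumps x) \<delta> t\<close>]) (use xg 1 in \<open>simp add: extends_def\<close>)
      ultimately show ?thesis by blast
    next
      case 2
      then show ?thesis using rk \<gamma> by blast
    next
      case 3
      have "rank_le (jumps g) 0 t"
        by (rule rank_le_gap[OF 3]) (use jumps_le_height[OF P(1)] in auto)
      then show ?thesis using \<beta> by blast
    qed
  qed
  then have "g \<in> subtree \<beta>" using P by (simp add: subtree_def rank_below_def)
  then show g: "g \<in> cone" by (rule cone_extends[OF x _ xg])
  note gD = coneD[OF g]
  have "\<phi> g s = h s" for s
  proof (cases "s < height g")
    case True
    obtain t where t: "max s (height x) < t" "t < height g"
      using dense[of "max s (height x)" "height g"] True ht by auto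
    then have "cut (\<phi> g) t = cut h t" using cut[of t] \<phi>_cut(2)[OF g, of t] xD(6) by simp
    then have "cut (\<phi> g) t s = cut h t s" by simp
    then show ?thesis using t by (simp add: cut_def)
  next
    case False
    then show ?thesis using stop_iff[OF gD(4), of s] stop_iff[OF P(2), of s] gD(5) hh by simp
  qed
  then show "\<phi> g = h" by blast
qed

lemma climb_zero:
  assumes x: "x \<in> cone" and e: "0 < e"
  obtains g h where "climb 0 x e g h"
proof -
  note xD = coneD[OF x]
  \<comment> \<open>The colour with which to leave \<open>x\<close> must not be the left limit of
    the colours of \<open>x\<close>, so that a jump arises at \<open>height x\<close>. As
    \<open>base\<close> and \<open>other\<close> cannot both be left limits, one of them will
    do.\<close>
  have "\<exists>c\<in>K. c \<noteq> stop \<and> (\<forall>s<height x. \<exists>u. s < u \<and> u < height x \<and> x u \<noteq> c)"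
  proof (rule ccontr)
    assume "\<not> ?thesis"
    then have *: "\<exists>s<height x. \<forall>u. s < u \<and> u < height x \<longrightarrow> x u = c" if "c \<in> K" "c \<noteq> stop" for c
      using that by blast
    obtain s where s: "s < height x" "\<And>u. s < u \<Longrightarrow> u < height x \<Longrightarrow> x u = base"
      using *[OF K(2) distinct(1)] by blast
    obtain r where r: "r < height x" "\<And>u. r < u \<Longrightarrow> u < height x \<Longrightarrow> x u = other"
      using *[OF K(3) distinct(2)] by blast
    obtain u where "max s r < u" "u < height x" using dense[of "max s r" "height x"] s(1) r(1) by auto
    then show False using s(2)[of u] r(2)[of u] distinct by simp
  qed
  then obtain c where c: "c \<in> K" "c \<noteq> stop"
    "\<And>s. s < height x \<Longrightarrow> \<exists>u. s < u \<and> u < height x \<and> x u \<noteq> c"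
    by blast
  define d where "d = e / 2"
  have d: "0 < d" "d < e" using e by (simp_all add: d_def)
  define g1 where "g1 = append_const x c d"
  have g1s: "g1 \<in> subtree \<beta>"
    unfolding g1_def by (rule append_const_in_subtree[OF xD(2) c(1,2) d(1) \<beta> xD(1)])
  have xg1: "extends x g1" unfolding g1_def by (rule extends_append_const[OF xD(2) c(1,2) d(1)])
  have hg1: "height g1 = height x + d" unfolding g1_def by (rule height_append_const[OF xD(2) c(1,2) d(1)])
  have g1: "g1 \<in> cone" by (rule cone_extends[OF x g1s xg1])
  note gD = coneD[OF g1]
  obtain r where r: "r > height x" "\<And>u. height x \<le> u \<Longrightarrow> u < r \<Longrightarrow> \<phi> g1 u = \<phi> g1 (height x)"
    using points_right_const[OF gD(4)] by blast
  \<comment> \<open>The path stops before the image can change colour, so neither \<open>g\<close>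
    nor \<open>h\<close> jumps strictly inside it.\<close>
  define p where "p = min r (height x + d)"
  have p: "height x < p" "p \<le> r" "p \<le> height g1" "p < height x + e"
    using r d hg1 by (auto simp: p_def)
  define g h where "g = cut g1 p" and "h = cut (\<phi> g1) p"
  have hg: "height g = p" and hh: "height h = p"
    using height_cut gD p by (simp_all add: g_def h_def)
  have gc: "g u = c" if "height x \<le> u" "u < p" for u
    using that p hg1 by (simp add: g_def g1_def append_const_def cut_def)
  have hc: "h u = \<phi> g1 (height x)" if "height x \<le> u" "u < p" for u
    using that p(2) r(2)[OF that(1)] by (simp add: h_def cut_def)
  have jg: "jumps f \<inter> {height x<..<p} = {}" if "\<And>u. height x \<le> u \<Longrightarrow> u < p \<Longrightarrow> f u = v" for f v
  proof -
    have "u \<notin> jumps f" if "height x < u" "u < p" for u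
      by (rule not_jumpI[OF that(1)]) (use that \<open>\<And>u. height x \<le> u \<Longrightarrow> u < p \<Longrightarrow> f u = v\<close> in simp)
    then show ?thesis by auto
  qed
  have "climb 0 x e g h"
    unfolding climb_def
  proof (intro conjI allI impI)
    show "g \<in> points" "h \<in> points" using cut_in_points gD p by (simp_all add: g_def h_def)
    show "extends x g" unfolding g_def using extends_to_cut[OF xg1] p by simp
    show "height x < height g" "height g < height x + e" "height h = height g"
      using hg hh p by simp_all
    show "cut g t \<in> subtree \<beta>" "\<phi> (cut g t) = cut h t" if "height x \<le> t \<and> t < height g" for t
    proof -
      have t: "height x0 \<le> t" "t \<le> height g1" "t \<le> p" using that hg p xD(6) by auto
      have "cut g t = cut g1 t" "cut h t = cut (\<phi> g1) t"
        unfolding g_def h_def using cut_cut t by simp_all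
      then show "cut g t \<in> subtree \<beta>" "\<phi> (cut g t) = cut h t"
        using \<phi>_cut[OF g1 t(1,2)] coneD(1) by simp_all
    qed
    show "height x \<in> jumps g"
    proof (rule ccontr)
      assume "height x \<notin> jumps g"
      then obtain s where s: "s < height x" "\<And>u. s < u \<Longrightarrow> u < height x \<Longrightarrow> g u = g (height x)"
        by (rule not_jumpE) (rule that)
      obtain u where u: "s < u" "u < height x" "x u \<noteq> c" using c(3)[OF s(1)] by blast
      have "g u = x u" using \<open>extends x g\<close> u by (simp add: extends_def)
      then show False using s(2)[OF u(1,2)] gc[of "height x"] u p by simp
    qed
    show "\<not> rank_le (jumps g) \<delta> (height g)" if "\<delta> < 0" for \<delta> using that by simp
    show "rank_le (jumps g) 0 t" "rank_le (jumps h) 0 t" if "height x < t \<and> t \<le> height g" for t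
    proof -
      have "jumps g \<inter> {height x<..<t} = {}" "jumps h \<inter> {height x<..<t} = {}"
        using that jg[of g, OF gc] jg[of h, OF hc] hg by auto
      then show "rank_le (jumps g) 0 t" "rank_le (jumps h) 0 t"
        using that rank_le_gap by blast+
    qed
  qed
  then show ?thesis using that by blast
qed

text \<open>
  Concatenating climbs of ranks \<open>d 0, d 1, \<dots>\<close>, where every rank below \<open>\<gamma>\<close> recurs infinitely often,
  gives a climb of rank exactly \<open>\<gamma>\<close>.
\<close>

lemma climb_limit:
  assumes x: "x \<in> cone" and e: "0 < e" and \<gamma>: "0 < \<gamma>" "\<gamma> \<le> \<beta>"
    and IH: "\<And>\<delta> x e. \<delta> < \<gamma> \<Longrightarrow> x \<in> cone \<Longrightarrow> 0 < e \<Longrightarrow> \<exists>g h. climb \<delta> x e g h"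
  obtains g h where "climb \<gamma> x e g h"
proof -
  have "{..<\<gamma>} \<noteq> {}" using \<gamma>(1) by auto
  then obtain d :: "nat \<Rightarrow> omega1" where d': "\<And>n. d n \<in> {..<\<gamma>}" and d_inf: "\<And>\<delta> N. \<delta> \<in> {..<\<gamma>} \<Longrightarrow> \<exists>n\<ge>N. d n = \<delta>"
    by (rule countable_enumeration_infinitely_often[OF countable_lessThan_omega1]) (rule that)
  have d: "d n < \<gamma>" "d n < \<beta>" for n using d'[of n] \<gamma>(2) by auto
  \<comment> \<open>The step lengths sum to \<open>e / 2\<close>, which leaves the height of the
    limit strictly below \<open>height x + e\<close>.\<close>
  define \<epsilon> where "\<epsilon> n = (e / 2) * (1 / 2) ^ Suc n" for n
  have \<epsilon>: "0 < \<epsilon> n" for n using e by (simp add: \<epsilon>_def)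
  have "\<exists>g h. climb (d n) z (\<epsilon> n) g h" if "z \<in> cone" for n z
    using IH[OF d(1) that \<epsilon>] .
  then have "\<forall>p. \<exists>q. snd p \<in> cone \<longrightarrow> climb (d (fst p)) (snd p) (\<epsilon> (fst p)) (fst q) (snd q)"
    by (metis fst_conv snd_conv)
  then obtain Q where Q: "\<And>p. snd p \<in> cone \<Longrightarrow> climb (d (fst p)) (snd p) (\<epsilon> (fst p)) (fst (Q p)) (snd (Q p))"
    using choice by metis
  define G H where "G n z = fst (Q (n, z))" and "H n z = snd (Q (n, z))" for n z
  have GH: "climb (d n) z (\<epsilon> n) (G n z) (H n z)" if "z \<in> cone" for n z
    using Q[of "(n, z)"] that by (simp add: G_def H_def)
  define X where "X = rec_nat x G"
  have X0: "X 0 = x" and XS: "X (Suc n) = G n (X n)" for n by (simp_all add: X_def)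
  have Xc: "X n \<in> cone" for n
  proof (induction n)
    case (Suc n)
    show ?case unfolding XS using climb_end(1)[OF GH[OF Suc] Suc d(2)] .
  qed (simp add: X0 x)
  have c: "climb (d n) (X n) (\<epsilon> n) (X (Suc n)) (\<phi> (X (Suc n)))" for n
    using GH[OF Xc, of n n] climb_end(2)[OF GH[OF Xc] Xc d(2), of n n] by (simp add: XS)
  note XD = coneD[OF Xc]
  have Xext: "extends (X n) (X (Suc n))" and Xlt: "height (X n) < height (X (Suc n))"
    and Xlt': "height (X (Suc n)) < height (X n) + \<epsilon> n" and Xj: "height (X n) \<in> jumps (X (Suc n))"
    and Xno: "\<And>\<delta>. \<delta> < d n \<Longrightarrow> \<not> rank_le (jumps (X (Suc n))) \<delta> (height (X (Suc n)))"
    and Xr: "\<And>t. height (X n) < t \<Longrightarrow> t \<le> height (X (Suc n)) \<Longrightarrow>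
      rank_le (jumps (X (Suc n))) (d n) t \<and> rank_le (jumps (\<phi> (X (Suc n)))) (d n) t" for n
    using c[of n] unfolding climb_def by blast+
  have bound: "height (X n) \<le> height x + (e / 2) * (1 - (1 / 2) ^ n)" for n
  proof (induction n)
    case (Suc n)
    then show ?case using Xlt'[of n] by (simp add: \<epsilon>_def algebra_simps)
  qed (simp add: X0)
  have bound': "height (X n) \<le> height x + e / 2" for n
  proof -
    have "(e / 2) * (1 - (1 / 2) ^ n) \<le> (e / 2) * 1" using e by (intro mult_left_mono) simp_all
    then show ?thesis using bound[of n] by simp
  qed
  define r where "r = (SUP n. height (X n))"
  have bdd: "bdd_above (range (\<lambda>n. height (X n)))" using bound' by (intro bdd_aboveI2)
  have le_r: "height (X n) < r" for n
    using cSUP_upper[OF UNIV_I bdd, of "Suc n"] Xlt[of n] unfolding r_def by simp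
  have r_le: "r \<le> height x + e / 2" unfolding r_def by (rule cSUP_least) (simp_all add: bound')
  have r_lim: "\<exists>n. t < height (X n)" if "t < r" for t
    using that less_cSUP_iff[OF _ bdd] unfolding r_def by blast
  obtain g where g: "g \<in> points" "height g = r" "\<And>n. extends (X n) g"
    by (rule chain_limit[of X r, OF XD(2) Xext le_r]) (erule r_lim, rule that)
  have "extends (\<phi> (X n)) (\<phi> (X (Suc n)))" for n
    by (rule \<phi>_extends[OF XD(1) XD(1) XD(3) Xext])
  then obtain h where h: "h \<in> points" "height h = r" "\<And>n. extends (\<phi> (X n)) h"
    using chain_limit[of "\<lambda>n. \<phi> (X n)" r] XD(4,5) le_r r_lim by auto
  have rank: "\<exists>\<delta><\<gamma>. rank_le (jumps g) \<delta> t \<and> rank_le (jumps h) \<delta> t" if t: "height x < t" "t < r" for t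
  proof -
    \<comment> \<open>The climb that contains \<open>t\<close>, counted with its upper end but not
      its lower one, matching the range in which \<open>climb\<close> bounds ranks.\<close>
    define k where "k = (LEAST n. t \<le> height (X n))"
    have "\<exists>n. t \<le> height (X n)" using r_lim[OF t(2)] less_imp_le by blast
    then have k: "t \<le> height (X k)" unfolding k_def by (rule LeastI_ex)
    then have "k \<noteq> 0" using t X0 by (metis not_less)
    then obtain n where n: "k = Suc n" using not0_implies_Suc by blast
    then have "height (X n) < t" using not_less_Least[of n "\<lambda>n. t \<le> height (X n)"] unfolding k_def[symmetric] by simp
    then have "rank_le (jumps (X (Suc n))) (d n) t" "rank_le (jumps (\<phi> (X (Suc n)))) (d n) t"
      using Xr[of n t] k n by simp_all
    moreover have "X (Suc n) s = g s" "\<phi> (X (Suc n)) s = h s" if "s < t" for s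
      using g(3)[of "Suc n"] h(3)[of "Suc n"] that k n XD(5) unfolding extends_def by simp_all
    ultimately have "rank_le (jumps g) (d n) t" "rank_le (jumps h) (d n) t"
      using rank_le_jumps_local by blast+
    then show ?thesis using d(1) by blast
  qed
  have jump: "height (X n) \<in> jumps g" for n
  proof (rule jumps_local[OF _ _ Xj])
    show "height (X n) - 1 < height (X n)" by simp
    show "X (Suc n) u = g u" if "u \<le> height (X n)" for u
      using g(3)[of "Suc n"] that Xlt[of n] by (simp add: extends_def)
  qed
  \<comment> \<open>A rank \<delta> < \<gamma> at \<open>r\<close> would force ranks below \<delta>
    on a left neighbourhood, yet a climb of rank exactly \<delta> ends inside it. The jumps at the
    ends of climbs exclude an empty neighbourhood.\<close>
  have no: "\<not> rank_le (jumps g) \<delta> r" if \<delta>: "\<delta> < \<gamma>" for \<delta>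
  proof
    assume "rank_le (jumps g) \<delta> r"
    then obtain s where s: "s < r"
      "jumps g \<inter> {s<..<r} = {} \<or> (\<forall>u\<in>{s<..<r}. \<exists>\<eta><\<delta>. rank_le (jumps g) \<eta> u)"
      by cases
    obtain N where N: "s < height (X N)" using r_lim[OF s(1)] by blast
    obtain n where n: "n \<ge> N" "d n = \<delta>" using d_inf \<delta> by blast
    have "height (X N) \<le> height (X n)"
      using extends_height_le[OF XD(2) XD(2)] extends_chain[of X, OF XD(2) Xext n(1)] by blast
    then have u: "height (X (Suc n)) \<in> {s<..<r}" using N Xlt[of n] le_r[of "Suc n"] by simp
    then obtain \<eta> where \<eta>: "\<eta> < \<delta>" "rank_le (jumps g) \<eta> (height (X (Suc n)))"
      using s(2) jump[of "Suc n"] by blast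
    have "rank_le (jumps (X (Suc n))) \<eta> (height (X (Suc n)))"
      by (rule rank_le_jumps_local[OF \<eta>(2)]) (use g(3)[of "Suc n"] in \<open>simp add: extends_def\<close>)
    then show False using Xno[of \<eta> n] \<eta>(1) n(2) by simp
  qed
  have "climb \<gamma> x e g h"
    unfolding climb_def
  proof (intro conjI allI impI)
    show "extends x g" using g(3)[of 0] X0 by simp
    show "height x < height g" using le_r[of 0] X0 g(2) by simp
    show "height g < height x + e" using r_le g(2) e by simp
    show "height h = height g" using h(2) g(2) by simp
    show "cut g t \<in> subtree \<beta>" "\<phi> (cut g t) = cut h t" if "height x \<le> t \<and> t < height g" for t
    proof -
      have "t < r" using that g(2) by simp
      then obtain n where n: "t < height (X n)" using r_lim by blast
      have t: "height x0 \<le> t" using that coneD(6)[OF x] by simp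
      have "cut g t = cut (X n) t" "cut h t = cut (\<phi> (X n)) t"
        using extends_cut_eq[OF g(3)] extends_cut_eq[OF h(3)] n XD(5) by simp_all
      then show "cut g t \<in> subtree \<beta>" "\<phi> (cut g t) = cut h t"
        using \<phi>_cut[OF Xc t, of n] coneD(1) n by simp_all
    qed
    show "height x \<in> jumps g" using jump[of 0] X0 by simp
    show "\<not> rank_le (jumps g) \<delta> (height g)" if "\<delta> < \<gamma>" for \<delta> using no[OF that] g(2) by simp
    show "rank_le (jumps g) \<gamma> t" "rank_le (jumps h) \<gamma> t" if "height x < t \<and> t \<le> height g" for t
      using that rank g(2) by (intro rank_leI[of "height x"]; fastforce)+
  qed (use g h in auto)
  then show ?thesis using that by blast
qed

lemma climb_exists:
  "\<gamma> \<le> \<beta> \<Longrightarrow> x \<in> cone \<Longrightarrow> 0 < e \<Longrightarrow> \<exists>g h. climb \<gamma> x e g h"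
proof (induction \<gamma> arbitrary: x e rule: less_induct)
  case (less \<gamma>)
  show ?case
  proof (cases "\<gamma> = 0")
    case True
    then show ?thesis using climb_zero[OF less.prems(2,3)] by metis
  next
    case False
    then have "0 < \<gamma>" using zero_le_omega1 by (simp add: order.strict_iff_order)
    moreover have "\<exists>g h. climb \<delta> z r g h" if "\<delta> < \<gamma>" "z \<in> cone" "0 < r" for \<delta> z r
      using less.IH[of \<delta> z r] that less.prems(1) by simp
    ultimately show ?thesis using climb_limit[OF less.prems(2,3) _ less.prems(1)] by metis
  qed
qed

text \<open>At full rank \<beta> the truncations above \<open>x0\<close> still lie in the subtree,
  but the end has left rank \<beta> and falls outside.\<close>

lemma climb_top:
  obtains g h where "g \<in> points" "h \<in> points" "g \<notin> subtree \<beta>" "height x0 < height g" "height h = height g"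
    "\<And>t. height x0 \<le> t \<Longrightarrow> t < height g \<Longrightarrow> cut g t \<in> cone \<and> \<phi> (cut g t) = cut h t"
    "\<And>t. height x0 < t \<Longrightarrow> t \<le> height g \<Longrightarrow> rank_le (jumps h) \<beta> t"
proof -
  have "x0 \<in> cone" using x0 by (simp add: cone_def)
  then obtain g h where c: "climb \<beta> x0 1 g h" using climb_exists[OF order_refl] zero_less_one by blast
  have "g \<notin> subtree \<beta>"
    using c unfolding climb_def subtree_def rank_below_def by blast
  moreover have "cut g t \<in> cone \<and> \<phi> (cut g t) = cut h t" if "height x0 \<le> t" "t < height g" for t
    using c that extends_to_cut[of x0 g t] unfolding climb_def cone_def by simp
  ultimately show ?thesis using that c unfolding climb_def by blast
qed

end

context coded_tree begin

section \<open>Incompleteness and non-isometry\<close>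

lemma subtree_incomplete:
  assumes \<alpha>: "0 < \<alpha>"
  shows "\<not> mcomplete_of (tree (subtree \<alpha>))"
proof
  assume "mcomplete_of (tree (subtree \<alpha>))"
  then have complete: "Metric_space.mcomplete (subtree \<alpha>) tree_dist"
    by (simp add: mcomplete_of_def subtree_subset)
  interpret M: Metric_space "subtree \<alpha>" tree_dist by (rule Metric_space_tree[OF subtree_subset])
  interpret climbing K stop base other \<alpha> "\<lambda>z. z" "origin 0"
    by unfold_locales (use \<alpha> origin_in_subtree subtree_points in auto)
  let ?o = "height (origin 0)"
  obtain g h where g: "g \<in> points" "g \<notin> subtree \<alpha>" "?o < height g"
    and cut_g: "\<And>t. ?o \<le> t \<Longrightarrow> t < height g \<Longrightarrow> cut g t \<in> cone \<and> cut g t = cut h t"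
    by (rule climb_top) (rule that)
  \<comment> \<open>The points \<open>\<sigma> n\<close> run up the climb to its missing end
    \<open>g\<close>.\<close>
  define s where "s n = (height g - ?o) / Suc n" for n
  define \<sigma> where "\<sigma> n = cut g (height g - s n)" for n
  have s: "0 < s n" "s n \<le> height g - ?o" for n
  proof -
    show "0 < s n" using g(3) by (simp add: s_def)
    have "(height g - ?o) / Suc n \<le> (height g - ?o) / 1"
      using g(3) by (intro divide_left_mono) simp_all
    then show "s n \<le> height g - ?o" by (simp add: s_def)
  qed
  have \<sigma>_in: "\<sigma> n \<in> subtree \<alpha>" for n
  proof -
    have "\<sigma> n \<in> cone"
      unfolding \<sigma>_def by (rule cut_g[THEN conjunct1]) (use s[of n] in auto)
    then show ?thesis by (rule coneD(1))
  qed
  have s_lim: "s \<longlonglongrightarrow> 0"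
    unfolding s_def using LIMSEQ_Suc[OF lim_const_over_n[of "height g - ?o"]] by simp
  have d\<sigma>: "tree_dist (\<sigma> m) (\<sigma> n) \<le> max (s m) (s n)" for m n
    using s[of m] s[of n] g(1)
    by (simp add: \<sigma>_def tree_dist_eq cut_in_points height_cut meet_cut meet_self min_def max_def)
  have dg: "tree_dist (\<sigma> n) g = s n" for n
    using s[of n] g(1) extends_cut[of g "height g - s n"]
    by (simp add: \<sigma>_def tree_dist_extends cut_in_points height_cut)
  have "M.MCauchy \<sigma>"
    unfolding M.MCauchy_def
  proof (intro conjI allI impI)
    show "range \<sigma> \<subseteq> subtree \<alpha>" using \<sigma>_in by blast
    fix e :: real assume "0 < e"
    then obtain N where N: "\<And>n. n \<ge> N \<Longrightarrow> \<bar>s n\<bar> < e"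
      using s_lim unfolding LIMSEQ_def dist_real_def by (metis diff_zero)
    show "\<exists>N. \<forall>n n'. N \<le> n \<longrightarrow> N \<le> n' \<longrightarrow> tree_dist (\<sigma> n) (\<sigma> n') < e"
    proof (intro exI[of _ N] allI impI)
      fix n n' assume "N \<le> n" "N \<le> n'"
      then show "tree_dist (\<sigma> n) (\<sigma> n') < e" using d\<sigma>[of n n'] N[of n] N[of n'] by linarith
    qed
  qed
  then obtain l where l: "limitin M.mtopology \<sigma> l sequentially"
    using complete unfolding M.mcomplete_def by blast
  then have lA: "l \<in> subtree \<alpha>" and l_lim: "\<And>e. e > 0 \<Longrightarrow> \<exists>N. \<forall>n\<ge>N. tree_dist (\<sigma> n) l < e"
    unfolding M.limit_metric_sequentially by blast+
  \<comment> \<open>Limits are unique among all points, so a limit inside the subtree would have to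
    be \<open>g\<close>.\<close>
  have "tree_dist l g \<le> 0"
  proof (rule field_le_epsilon)
    fix e :: real assume e: "0 < e"
    then have e2: "0 < e / 2" by simp
    obtain N where N: "\<And>n. n \<ge> N \<Longrightarrow> tree_dist (\<sigma> n) l < e / 2" using l_lim[OF e2] by blast
    obtain N' where N': "\<And>n. n \<ge> N' \<Longrightarrow> \<bar>s n\<bar> < e / 2"
      using s_lim e2 unfolding LIMSEQ_def dist_real_def by (metis diff_zero)
    let ?n = "max N N'"
    have "tree_dist l g \<le> tree_dist l (\<sigma> ?n) + tree_dist (\<sigma> ?n) g"
      by (rule Metric_space.triangle[OF Metric_space_points]) (use lA \<sigma>_in subtree_points g in auto)
    then show "tree_dist l g \<le> 0 + e"
      using N[of ?n] N'[of ?n] dg[of ?n] tree_dist_commute[of l "\<sigma> ?n"] by simp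
  qed
  then have "l = g"
    using tree_dist_pos[of l g] lA g(1) subtree_points by fastforce
  with lA g(2) show False by simp
qed

text \<open>Once a point \<open>y\<close> below \<open>x\<close> is known, extending
  \<open>x\<close> means having \<open>x\<close> between \<open>y\<close> and \<open>z\<close>, a
  metric condition. If \<open>z'\<close> did not extend \<open>x'\<close>, both \<open>y'\<close>
  and \<open>z'\<close> would lie in the downward direction at \<open>x'\<close> and betweenness
  would fail.\<close>

lemma extends_transfer:
  assumes P: "y \<in> points" "x \<in> points" "z \<in> points" "y' \<in> points" "x' \<in> points" "z' \<in> points"
    and d: "tree_dist y' x' = tree_dist y x" "tree_dist x' z' = tree_dist x z" "tree_dist y' z' = tree_dist y z"
    and ext: "extends y x" "y \<noteq> x" "extends y' x'" "extends x z"
  shows "extends x' z'"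
proof (rule ccontr)
  assume neg: "\<not> extends x' z'"
  have "tree_dist y x > 0" using tree_dist_pos P ext by blast
  then have "y' \<noteq> x'" using d(1) Metric_space.zero[OF Metric_space_points P(5,5)] by auto
  then have "\<not> extends x' y'"
    using extends_antisym[OF P(4,5) ext(3)] extends_height_le[OF P(5,4)] by blast
  then have "tree_dist y' z' < tree_dist y' x' + tree_dist x' z'"
    using tree_dist_less_add[OF P(5,4,6)] neg by blast
  moreover have "tree_dist y z = tree_dist y x + tree_dist x z"
    using tree_dist_extends P ext extends_trans[OF P(1,2) ext(1,4)] by simp
  ultimately show False using d by simp
qed

text \<open>The climb ends outside the \<beta>-th subtree, whereas the end \<open>h\<close> of its
  image has left ranks at most \<beta> < \<alpha> above \<open>x\<close> and belongs to the
  \<alpha>-th. A preimage of \<open>h\<close> would share its truncations with the missing end,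
  hence be that end.\<close>

lemma subtree_not_isometric_aux:
  assumes \<beta>: "0 < \<beta>" and \<alpha>: "\<beta> < \<alpha>"
    and \<phi>: "\<phi> ` subtree \<beta> = subtree \<alpha>"
    and iso: "\<And>x y. x \<in> subtree \<beta> \<Longrightarrow> y \<in> subtree \<beta> \<Longrightarrow> tree_dist (\<phi> x) (\<phi> y) = tree_dist x y"
    and y: "y \<in> subtree \<beta>" and x: "x \<in> subtree \<beta>" and yx: "extends y x" "y \<noteq> x" "extends (\<phi> y) (\<phi> x)"
    and height: "height (\<phi> x) = height x"
  shows False
proof -
  have pt: "z \<in> points" "\<phi> z \<in> points" if "z \<in> subtree \<beta>" for z
    using that \<phi> subtree_points by blast+
  \<comment> \<open>A point \<open>u\<close> above \<open>y\<close> that is carried upwards at equal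
    height passes this on to everything above it: order by betweenness, height by distance.\<close>
  have up: "extends (\<phi> u) (\<phi> z)" "height (\<phi> z) = height z"
    if "u \<in> subtree \<beta>" "z \<in> subtree \<beta>" "extends y u" "y \<noteq> u" "extends (\<phi> y) (\<phi> u)" "height (\<phi> u) = height u" "extends u z" for u z
  proof -
    show ext: "extends (\<phi> u) (\<phi> z)"
      by (rule extends_transfer[of y u z "\<phi> y" "\<phi> u" "\<phi> z"]) (use that y pt iso in auto)
    show "height (\<phi> z) = height z"
      using tree_dist_extends[OF pt(2)[OF that(1)] pt(2)[OF that(2)] ext]
        tree_dist_extends[OF pt(1)[OF that(1)] pt(1)[OF that(2)] that(7)] iso[OF that(1,2)] that(6) by simp
  qed
  note up_x = up[OF x _ yx height]
  interpret climbing K stop base other \<beta> \<phi> x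
  proof unfold_locales
    fix z assume z: "z \<in> subtree \<beta>" "extends x z"
    show "\<phi> z \<in> points" by (rule pt(2)[OF z(1)])
    show "height (\<phi> z) = height z" by (rule up_x(2)[OF z])
    fix w assume w: "w \<in> subtree \<beta>" "extends z w"
    have "extends y z" by (rule extends_trans[OF pt(1)[OF y] pt(1)[OF x] yx(1) z(2)])
    moreover have "extends (\<phi> y) (\<phi> z)"
      by (rule extends_trans[OF pt(2)[OF y] pt(2)[OF x] yx(3) up_x(1)[OF z]])
    moreover have "y \<noteq> z"
      using extends_antisym[OF pt(1)[OF y] pt(1)[OF x] yx(1)] extends_height_le[OF pt(1)[OF x] pt(1)[OF y]] z(2) yx(2) by blast
    ultimately show "extends (\<phi> z) (\<phi> w)" using up(1)[OF z(1) w(1)] up_x(2)[OF z] w(2) by blast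
  qed (use \<beta> x in auto)
  obtain g h where P: "g \<in> points" "h \<in> points" and g: "g \<notin> subtree \<beta>" "height x < height g"
    and hh: "height h = height g"
    and cut_g: "\<And>t. height x \<le> t \<Longrightarrow> t < height g \<Longrightarrow> cut g t \<in> cone \<and> \<phi> (cut g t) = cut h t"
    and rk: "\<And>t. height x < t \<Longrightarrow> t \<le> height g \<Longrightarrow> rank_le (jumps h) \<beta> t"
    by (rule climb_top) (rule that)
  have ch: "cut h t \<in> subtree \<alpha>" if "height x \<le> t" "t < height g" for t
    using cut_g[OF that] \<phi> coneD(1) by (metis imageI)
  have "\<exists>\<delta><\<alpha>. rank_le (jumps h) \<delta> t" for t
  proof -
    consider "t \<le> height x" | "height x < t" "t \<le> height g" | "height g < t" by linarith
    then show ?thesis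
    proof cases
      case 1
      obtain \<delta> where \<delta>: "\<delta> < \<alpha>" "rank_le (jumps (cut h (height x))) \<delta> t"
        using ch[OF order_refl g(2)] unfolding subtree_def rank_below_def by blast
      have "rank_le (jumps h) \<delta> t"
        by (rule rank_le_jumps_local[OF \<delta>(2)]) (use 1 in \<open>simp add: cut_def\<close>)
      then show ?thesis using \<delta>(1) by blast
    next
      case 2
      then show ?thesis using rk \<alpha> by blast
    next
      case 3
      have "rank_le (jumps h) 0 t"
        by (rule rank_le_gap[OF 3]) (use jumps_le_height[OF P(2)] hh in auto)
      then show ?thesis using \<alpha> \<beta> by (meson less_trans)
    qed
  qed
  then have "h \<in> subtree \<alpha>" using P by (simp add: subtree_def rank_below_def)
  then have "h \<in> \<phi> ` subtree \<beta>" by (simp add: \<phi>)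
  then obtain z where z: "z \<in> subtree \<beta>" "\<phi> z = h" by (metis imageE)
  have "x \<in> points" using pt x by blast
  have "cut g (height x) \<in> cone" using cut_g[OF order_refl g(2)] by blast
  then have "x = cut g (height x)"
    using extends_antisym[OF \<open>x \<in> points\<close> coneD(2) coneD(3)] height_cut[OF P(1)] g(2) by simp
  then have "\<phi> x = cut h (height x)" using cut_g[OF order_refl g(2)] by simp
  then have "extends (\<phi> x) h" using extends_cut[OF P(2)] g(2) hh by simp
  then have "extends (\<phi> x) (\<phi> z)" by (simp add: z(2))
  moreover have "\<phi> y \<noteq> \<phi> x"
    using iso[OF y x] tree_dist_pos[OF pt(1)[OF y] pt(1)[OF x] yx(2)]
      Metric_space.zero[OF Metric_space_points pt(2)[OF y] pt(2)[OF x]] by linarith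
  \<comment> \<open>The transfer is applied backwards, from images to sources, to place the preimage
    \<open>z\<close> above \<open>x\<close>.\<close>
  ultimately have xz: "extends x z"
    using iso[OF y x] iso[OF x z(1)] iso[OF y z(1)]
    by (intro extends_transfer[OF pt(2)[OF y] pt(2)[OF x] pt(2)[OF z(1)] pt(1)[OF y] pt(1)[OF x] pt(1)[OF z(1)]
          _ _ _ yx(3) _ yx(1)]) simp_all
  then have zc: "z \<in> cone" using z by (simp add: cone_def)
  note zD = coneD[OF zc]
  have hz: "height z = height g" using zD(5) z(2) hh by simp
  have "z s = g s" for s
  proof (cases "s < height g")
    case True
    obtain t where t: "max s (height x) < t" "t < height g"
      using dense[of "max s (height x)" "height g"] True g(2) by auto
    then have ct: "height x \<le> t" "t \<le> height z" using hz by simp_all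
    have cz: "cut z t \<in> cone" "\<phi> (cut z t) = cut h t" using \<phi>_cut[OF zc ct] z(2) by simp_all
    have cg: "cut g t \<in> cone" "\<phi> (cut g t) = cut h t" using cut_g[of t] t by simp_all
    have "tree_dist (cut z t) (cut g t) = tree_dist (cut h t) (cut h t)"
      using iso[OF coneD(1)[OF cz(1)] coneD(1)[OF cg(1)]] cz(2) cg(2) by simp
    also have "\<dots> = 0"
      using Metric_space.zero[OF Metric_space_points coneD(4)[OF cg(1)] coneD(4)[OF cg(1)]] cg(2) by simp
    finally have "cut z t = cut g t"
      using tree_dist_pos[OF coneD(2)[OF cz(1)] coneD(2)[OF cg(1)]] by fastforce
    then have "cut z t s = cut g t s" by simp
    then show ?thesis using t by (simp add: cut_def)
  next
    case False
    then show ?thesis using stop_iff[OF zD(2), of s] stop_iff[OF P(1), of s] hz by simp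
  qed
  then have "z = g" by blast
  then show False using z(1) g(1) by simp
qed

lemma extends_translate:
  "f \<in> points \<Longrightarrow> g \<in> points \<Longrightarrow> extends f g \<Longrightarrow> extends (translate c f) (translate c g)"
  by (simp add: extends_iff_meet translate_in_points meet_translate height_translate)

theorem subtree_not_isometric_less:
  assumes \<beta>: "0 < \<beta>" and \<alpha>: "\<beta> < \<alpha>"
  shows "\<not> isometric (tree (subtree \<beta>)) (tree (subtree \<alpha>))"
proof
  assume "isometric (tree (subtree \<beta>)) (tree (subtree \<alpha>))"
  then obtain \<phi> where \<phi>: "\<phi> ` subtree \<beta> = subtree \<alpha>"
    and iso: "\<And>x y. x \<in> subtree \<beta> \<Longrightarrow> y \<in> subtree \<beta> \<Longrightarrow> tree_dist (\<phi> x) (\<phi> y) = tree_dist x y"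
    unfolding isometric_def isometry_def isometric_embedding_def
    by (auto simp: subtree_subset)
  have pt: "z \<in> points" "\<phi> z \<in> points" if "z \<in> subtree \<beta>" for z
    using that \<phi> subtree_points by blast+
  \<comment> \<open>Two points in different upward directions at \<open>y\<close>. Their images are
    separated by that of \<open>y\<close>, so they cannot both lie in its downward
    direction.\<close>
  define y p q where "y = origin 0" and "p = append_const y base 1" and "q = append_const y other 1"
  have y: "y \<in> subtree \<beta>" unfolding y_def by (rule origin_in_subtree[OF \<beta>])
  note yP = pt(1)[OF y]
  have p: "p \<in> subtree \<beta>" "extends y p" "label y p = base" "height p = height y + 1"
    unfolding p_def using yP K distinct \<beta> y
    by (simp_all add: append_const_in_subtree extends_append_const label_append_const height_append_const)
  have q: "q \<in> subtree \<beta>" "extends y q" "label y q = other" "height q = height y + 1"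
    unfolding q_def using yP K distinct \<beta> y
    by (simp_all add: append_const_in_subtree extends_append_const label_append_const height_append_const)
  have ne: "p \<noteq> y" "q \<noteq> y" using p(4) q(4) by auto
  have "tree_dist p q = tree_dist p y + tree_dist y q"
    using label_neq_iff[OF yP pt(1)[OF p(1)] pt(1)[OF q(1)] ne] p(3) q(3) distinct by simp
  then have "tree_dist (\<phi> p) (\<phi> q) = tree_dist (\<phi> p) (\<phi> y) + tree_dist (\<phi> y) (\<phi> q)"
    using iso p(1) q(1) y by simp
  then have "extends (\<phi> y) (\<phi> p) \<or> extends (\<phi> y) (\<phi> q)"
    using tree_dist_less_add[OF pt(2)[OF y] pt(2)[OF p(1)] pt(2)[OF q(1)]] by auto
  then obtain x where x: "x \<in> subtree \<beta>" "extends y x" "y \<noteq> x" "extends (\<phi> y) (\<phi> x)"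
    using p q ne by metis
  \<comment> \<open>The translation removes the height difference at \<open>x\<close> and preserves
    the target subtree.\<close>
  define \<phi>' where "\<phi>' z = translate (height x - height (\<phi> x)) (\<phi> z)" for z
  have "\<phi>' ` subtree \<beta> = subtree \<alpha>"
  proof
    show "\<phi>' ` subtree \<beta> \<subseteq> subtree \<alpha>" using \<phi> translate_in_subtree by (auto simp: \<phi>'_def)
    show "subtree \<alpha> \<subseteq> \<phi>' ` subtree \<beta>"
    proof
      fix w assume "w \<in> subtree \<alpha>"
      then have "translate (- (height x - height (\<phi> x))) w \<in> \<phi> ` subtree \<beta>"
        unfolding \<phi> by (rule translate_in_subtree)
      then obtain z where "z \<in> subtree \<beta>" "\<phi> z = translate (- (height x - height (\<phi> x))) w" by auto
      then show "w \<in> \<phi>' ` subtree \<beta>"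
        by (intro rev_image_eqI[of z]) (simp_all only: \<phi>'_def translate_inverse)
    qed
  qed
  then show False
  proof (rule subtree_not_isometric_aux[OF \<beta> \<alpha> _ _ y x(1,2,3)])
    show "tree_dist (\<phi>' u) (\<phi>' v) = tree_dist u v" if "u \<in> subtree \<beta>" "v \<in> subtree \<beta>" for u v
      using that by (simp add: \<phi>'_def tree_dist_translate pt iso)
    show "extends (\<phi>' y) (\<phi>' x)"
      unfolding \<phi>'_def by (rule extends_translate[OF pt(2)[OF y] pt(2)[OF x(1)] x(4)])
    show "height (\<phi>' x) = height x"
      by (simp add: \<phi>'_def height_translate pt x(1))
  qed
qed

end

section \<open>The direct union\<close>

lemma isometric_sym:
  assumes "isometric m n" shows "isometric n m"
proof -
  obtain f where f: "f \<in> mspace m \<rightarrow> mspace n" "f ` mspace m = mspace n"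
    "\<And>x y. x \<in> mspace m \<Longrightarrow> y \<in> mspace m \<Longrightarrow> mdist n (f x) (f y) = mdist m x y"
    using assms unfolding isometric_def isometry_def isometric_embedding_def by blast
  have "inj_on f (mspace m)"
    by (rule inj_onI) (metis f(3) mdist_zero)
  then have bij: "bij_betw f (mspace m) (mspace n)" using f(2) by (simp add: bij_betw_def)
  let ?g = "inv_into (mspace m) f"
  have g: "bij_betw ?g (mspace n) (mspace m)" by (rule bij_betw_inv_into[OF bij])
  have "mdist m (?g x) (?g y) = mdist n x y" if "x \<in> mspace n" "y \<in> mspace n" for x y
    using f(3)[of "?g x" "?g y"] that bij_betw_apply[OF g] bij_betw_inv_into_right[OF bij] by simp
  then have "isometry n m ?g"
    unfolding isometry_def isometric_embedding_def using g by (auto simp: bij_betw_def)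
  then show ?thesis unfolding isometric_def by blast
qed

text \<open>With inclusions as transition maps, all members of a class have the same second
  component, which identifies the class with a point of the union.\<close>

lemma direct_union_inclusions:
  fixes T :: "'i::linorder \<Rightarrow> 'a metric" and U :: "'a metric"
  assumes mono: "\<And>i j. i \<in> I \<Longrightarrow> j \<in> I \<Longrightarrow> i < j \<Longrightarrow> mspace (T i) \<subseteq> mspace (T j)"
    and dist: "\<And>i x y. i \<in> I \<Longrightarrow> x \<in> mspace (T i) \<Longrightarrow> y \<in> mspace (T i) \<Longrightarrow> mdist (T i) x y = mdist U x y"
    and union: "(\<Union>i\<in>I. mspace (T i)) = mspace U"
  shows "isometric (direct_union I T (\<lambda>i j x. x)) U"
proof -
  let ?\<psi> = "\<lambda>(i::'i) (j::'i) (x::'a). x"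
  let ?R = "direct_union_rel I T ?\<psi>" and ?C = "direct_union_carrier I T ?\<psi>"
  have tr: "transition ?\<psi> i j x = x" for i j x by (simp add: transition_def)
  have emb: "isometric_embedding (T i) (T j) (?\<psi> i j)" if "i \<in> I" "j \<in> I" "i < j" for i j
    using mono[OF that] dist that by (auto simp: isometric_embedding_def subset_iff)
  have mle: "mspace (T i) \<subseteq> mspace (T j)" if "i \<in> I" "j \<in> I" "i \<le> j" for i j
    using mono that by (cases "i = j") auto
  interpret D: Metric_space ?C "direct_union_dist I T ?\<psi>"
    by (rule Metric_space_direct_union[OF emb]) simp_all
  have R: "?R `` {(i, x)} = {(j, x) | j. j \<in> I \<and> x \<in> mspace (T j)}" if "i \<in> I" "x \<in> mspace (T i)" for i x
  proof -
    have "\<exists>k\<in>I. i \<le> k \<and> j \<le> k" if "j \<in> I" for j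
      using that \<open>i \<in> I\<close> by (intro bexI[of _ "max i j"]) (auto simp: max_def)
    then show ?thesis using that unfolding direct_union_rel_def tr by auto
  qed
  define F :: "('i \<times> 'a) set \<Rightarrow> 'a" where "F X = the_elem (snd ` X)" for X
  have F: "F (?R `` {(i, x)}) = x" if "i \<in> I" "x \<in> mspace (T i)" for i x
  proof -
    have "snd ` (?R `` {(i, x)}) = {x}" unfolding R[OF that] using that by force
    then show ?thesis by (simp add: F_def)
  qed
  have C: "?C = (\<lambda>(i, x). ?R `` {(i, x)}) ` (SIGMA i:I. mspace (T i))"
    unfolding direct_union_carrier_def quotient_def by auto
  have "F ` ?C = mspace U"
    unfolding C union[symmetric] using F by (force simp: image_iff)
  moreover have "mdist U (F X) (F Y) = direct_union_dist I T ?\<psi> X Y" if XY: "X \<in> ?C" "Y \<in> ?C" for X Y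
  proof -
    obtain i x j y where *: "X = ?R `` {(i, x)}" "i \<in> I" "x \<in> mspace (T i)"
      "Y = ?R `` {(j, y)}" "j \<in> I" "y \<in> mspace (T j)" using XY unfolding C by auto
    let ?k = "max i j"
    have k: "?k \<in> I" using * by (simp add: max_def)
    have "direct_union_dist I T ?\<psi> X Y = mdist (T ?k) (transition ?\<psi> i ?k x) (transition ?\<psi> j ?k y)"
      unfolding *(1,4) by (rule direct_union_dist_eq[OF emb]) (use * k in simp_all)
    also have "\<dots> = mdist U x y"
      unfolding tr using * k mle[of i ?k] mle[of j ?k] by (intro dist) auto
    finally show ?thesis using F * by simp
  qed
  ultimately have "isometry (direct_union I T ?\<psi>) U F"
    unfolding isometry_def isometric_embedding_def direct_union_def
    by (auto simp: D.mspace_metric D.mdist_metric)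
  then show ?thesis unfolding isometric_def by blast
qed

theorem theorem1p1:
  fixes \<kappa> :: "'k rel"
  assumes "Card_order \<kappa>" and "|{..<3::nat}| \<le>o \<kappa>"
  shows "\<exists>(T :: omega1 \<Rightarrow> (real \<Rightarrow> 'k) metric) (\<psi> :: omega1 \<Rightarrow> omega1 \<Rightarrow> (real \<Rightarrow> 'k) \<Rightarrow> (real \<Rightarrow> 'k)).
    (\<forall>\<alpha>\<ge>1. real_tree (T \<alpha>) \<and> has_valence (T \<alpha>) \<kappa> \<and> homogeneous (T \<alpha>) \<and> \<not> mcomplete_of (T \<alpha>)) \<and>
    (\<forall>\<alpha> \<beta>. 1 \<le> \<alpha> \<and> \<alpha> < \<beta> \<longrightarrow> isometric_embedding (T \<alpha>) (T \<beta>) (\<psi> \<alpha> \<beta>)) \<and>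
    (\<forall>\<alpha> \<beta>. 1 \<le> \<alpha> \<and> 1 \<le> \<beta> \<and> \<alpha> \<noteq> \<beta> \<longrightarrow> \<not> isometric (T \<alpha>) (T \<beta>)) \<and>
    (\<forall>\<alpha> \<beta> \<gamma>. 1 \<le> \<alpha> \<and> \<alpha> < \<beta> \<and> \<beta> < \<gamma> \<longrightarrow>
       (\<forall>x\<in>mspace (T \<alpha>). \<psi> \<alpha> \<gamma> x = (\<psi> \<beta> \<gamma> \<circ> \<psi> \<alpha> \<beta>) x)) \<and>
    (\<exists>U :: (real \<Rightarrow> 'k) metric. universal_real_tree \<kappa> U \<and> isometric (direct_union {1..} T \<psi>) U)"
proof -
  have field: "|Field \<kappa>| =o \<kappa>" using assms(1) by (rule card_of_Field_ordIso)
  then have "|{..<3::nat}| \<le>o |Field \<kappa>|"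
    using assms(2) ordIso_symmetric ordLeq_ordIso_trans by blast
  then obtain f :: "nat \<Rightarrow> 'k" where f: "inj_on f {..<3}" "f ` {..<3} \<subseteq> Field \<kappa>"
    unfolding card_of_ordLeq[symmetric] by blast
  obtain stop base other where
    "stop \<in> Field \<kappa>" "base \<in> Field \<kappa>" "other \<in> Field \<kappa>" "base \<noteq> stop" "other \<noteq> stop" "other \<noteq> base"
  proof (rule that)
    show "f 0 \<in> Field \<kappa>" "f 1 \<in> Field \<kappa>" "f 2 \<in> Field \<kappa>" using f(2) by auto
    show "f 1 \<noteq> f 0" "f 2 \<noteq> f 0" "f 2 \<noteq> f 1" using inj_onD[OF f(1)] by force+
  qed
  \<comment> \<open>One element of the field serves as \<open>stop\<close>, so directions are
    indexed by the whole field and finite \<kappa> needs no separate treatment.\<close>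
  then interpret coded_tree "Field \<kappa>" stop base other by unfold_locales
  \<comment> \<open>All subtrees lie in one set of points, so the embeddings are inclusions and the
    composition law is immediate.\<close>
  let ?T = "\<lambda>\<alpha>. tree (subtree \<alpha>)" and ?\<psi> = "\<lambda>(\<alpha>::omega1) (\<beta>::omega1) (x :: real \<Rightarrow> 'k). x"
  note simps = mspace_tree[OF subtree_subset] mdist_tree[OF subtree_subset]
  have tree: "real_tree (?T \<alpha>) \<and> has_valence (?T \<alpha>) \<kappa> \<and> homogeneous (?T \<alpha>) \<and> \<not> mcomplete_of (?T \<alpha>)"
    if "0 < \<alpha>" for \<alpha>
  proof (intro conjI)
    show "real_tree (?T \<alpha>)"
      using real_tree_tree[OF subtree_subset cut_closed_subtree[OF that]] origin_in_subtree[OF that] by blast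
    show "has_valence (?T \<alpha>) \<kappa>"
      unfolding has_valence_def simps using ordIso_transitive[OF valence_subtree[OF that] field] by blast
    show "homogeneous (?T \<alpha>)" by (rule homogeneous_subtree)
    show "\<not> mcomplete_of (?T \<alpha>)" by (rule subtree_incomplete[OF that])
  qed
  have emb: "isometric_embedding (?T \<alpha>) (?T \<beta>) (?\<psi> \<alpha> \<beta>)" if "\<alpha> < \<beta>" for \<alpha> \<beta>
    unfolding isometric_embedding_def simps using subtree_mono[OF less_imp_le[OF that]] by auto
  have not_isometric: "\<not> isometric (?T \<alpha>) (?T \<beta>)" if "0 < \<alpha>" "0 < \<beta>" "\<alpha> \<noteq> \<beta>" for \<alpha> \<beta>
    using subtree_not_isometric_less[of \<alpha> \<beta>] subtree_not_isometric_less[of \<beta> \<alpha>]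
      isometric_sym[of "?T \<alpha>" "?T \<beta>"] that by (meson linorder_neqE)
  have "universal_real_tree \<kappa> (tree points)"
    unfolding universal_real_tree_def
  proof (intro conjI)
    show "real_tree (tree points)"
      using real_tree_tree[OF order_refl cut_closed_points] origin_in_points by blast
    show "mcomplete_of (tree points)" using mcomplete_points by (simp add: mcomplete_of_def)
    show "has_valence (tree points) \<kappa>"
      unfolding has_valence_def mspace_tree[OF order_refl] using ordIso_transitive[OF valence_points field] by blast
  qed
  moreover have "isometric (direct_union {1..} ?T ?\<psi>) (tree points)"
  proof (rule direct_union_inclusions)
    show "mspace (?T i) \<subseteq> mspace (?T j)" if "i < j" for i j
      unfolding simps using subtree_mono that by (simp add: less_imp_le)
    have "f \<in> (\<Union>i\<in>{1..}. subtree i)" if "f \<in> points" for f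
    proof -
      obtain \<alpha> where "0 < \<alpha>" "f \<in> subtree \<alpha>" using points_in_subtree[OF \<open>f \<in> points\<close>] by blast
      then show ?thesis using one_le_omega1_iff[of \<alpha>] by auto
    qed
    then show "(\<Union>i\<in>{1..}. mspace (?T i)) = mspace (tree points)"
      unfolding simps using subtree_points by auto
  qed (simp add: simps)
  ultimately show ?thesis
    using tree emb not_isometric
    by (intro exI[of _ ?T] exI[of _ ?\<psi>]) (auto simp: one_le_omega1_iff)
qed

end
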